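(* Let $D$ be a normal domain, let $f\in D$ be a nonzero nonunit, let $n\in\mathbb{N}$, and let $A$ be a $1$-principled $n\times n$-matrix over $D/fD$. Then $A^m$ is $1$-principled for every $m\in\mathbb{Z}$.
   Context: All rings are commutative, associative and unital; $\mathbb{N}=\{0,1,2,\ldots\}$ and $[n]:=\{1,2,\ldots,n\}$. A normal domain is an integral domain that is integrally closed in its fraction field. For an $n\times n$-matrix $A$ over a ring and $S\subseteq[n]$, $A_S$ denotes the principal submatrix of $A$ with row and column set $S$; the empty determinant is $1$. The matrix $A$ is $1$-principled if $\det A_S = 1$ for every $S\subseteq[n]$. (Such a matrix has determinant $1$, hence is invertible, so $A^m$ is defined for every integer $m$.) *)

theory Defs
  imports "HOL-Algebra.Polynomials" "HOL-Algebra.QuotRing" "HOL-Combinatorics.Permutations"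
begin

section \<open>The field of fractions of a domain\<close>

definition frac_rel :: "('a, 'b) ring_scheme \<Rightarrow> (('a \<times> 'a) \<times> ('a \<times> 'a)) set" where
  "frac_rel D = {((a, b), (c, d)).
     a \<in> carrier D \<and> b \<in> carrier D - {\<zero>\<^bsub>D\<^esub>} \<and> c \<in> carrier D \<and> d \<in> carrier D - {\<zero>\<^bsub>D\<^esub>} \<and>
     a \<otimes>\<^bsub>D\<^esub> d = c \<otimes>\<^bsub>D\<^esub> b}"

definition mk_frac :: "('a, 'b) ring_scheme \<Rightarrow> 'a \<Rightarrow> 'a \<Rightarrow> ('a \<times> 'a) set" where
  "mk_frac D a b = frac_rel D `` {(a, b)}"

definition frac_field :: "('a, 'b) ring_scheme \<Rightarrow> ('a \<times> 'a) set ring" where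
  "frac_field D =
    \<lparr>carrier = (carrier D \<times> (carrier D - {\<zero>\<^bsub>D\<^esub>})) // frac_rel D,
     mult = (\<lambda>x y. \<Union>(a, b)\<in>x. \<Union>(c, d)\<in>y. mk_frac D (a \<otimes>\<^bsub>D\<^esub> c) (b \<otimes>\<^bsub>D\<^esub> d)),
     one = mk_frac D \<one>\<^bsub>D\<^esub> \<one>\<^bsub>D\<^esub>,
     zero = mk_frac D \<zero>\<^bsub>D\<^esub> \<one>\<^bsub>D\<^esub>,
     add = (\<lambda>x y. \<Union>(a, b)\<in>x. \<Union>(c, d)\<in>y.
              mk_frac D (a \<otimes>\<^bsub>D\<^esub> d \<oplus>\<^bsub>D\<^esub> c \<otimes>\<^bsub>D\<^esub> b) (b \<otimes>\<^bsub>D\<^esub> d))\<rparr>"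

definition frac_embed :: "('a, 'b) ring_scheme \<Rightarrow> 'a \<Rightarrow> ('a \<times> 'a) set" where
  "frac_embed D a = mk_frac D a \<one>\<^bsub>D\<^esub>"

lemma UN_pairs_const:
  assumes "(a, b) \<in> P" "(c, d) \<in> Q"
    and "\<And>a b c d. (a, b) \<in> P \<Longrightarrow> (c, d) \<in> Q \<Longrightarrow> F a b c d = K"
  shows "(\<Union>(a, b)\<in>P. \<Union>(c, d)\<in>Q. F a b c d) = K"
proof -
  have "(\<Union>(c, d)\<in>Q. F a b c d) = K" if "(a, b) \<in> P" for a b
  proof -
    have "(\<Union>(c, d)\<in>Q. F a b c d) = (\<Union>q\<in>Q. K)"
      by (intro SUP_cong refl) (clarsimp simp: assms(3)[OF that])
    then show ?thesis using assms(2) by auto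
  qed
  then have "(\<Union>(a, b)\<in>P. \<Union>(c, d)\<in>Q. F a b c d) = (\<Union>p\<in>P. K)"
    by (intro SUP_cong refl) clarsimp
  then show ?thesis using assms(1) by auto
qed

context domain
begin

lemma equiv_frac_rel: "equiv (carrier R \<times> (carrier R - {\<zero>})) (frac_rel R)"
proof (rule equivI)
  show "refl_on (carrier R \<times> (carrier R - {\<zero>})) (frac_rel R)"
    by (auto simp: refl_on_def frac_rel_def)
  show "frac_rel R \<subseteq> (carrier R \<times> (carrier R - {\<zero>})) \<times> (carrier R \<times> (carrier R - {\<zero>}))"
    by (auto simp: frac_rel_def)
  show "sym (frac_rel R)"
    by (auto simp: sym_def frac_rel_def)
  show "trans (frac_rel R)"
  proof (rule transI)
    fix x y z assume xy: "(x, y) \<in> frac_rel R" and yz: "(y, z) \<in> frac_rel R"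
    obtain a b c d e g where [simp]: "x = (a, b)" "y = (c, d)" "z = (e, g)"
      by (metis prod.exhaust)
    have C: "a \<in> carrier R" "b \<in> carrier R" "c \<in> carrier R" "d \<in> carrier R"
            "e \<in> carrier R" "g \<in> carrier R" "b \<noteq> \<zero>" "d \<noteq> \<zero>" "g \<noteq> \<zero>"
      and 1: "a \<otimes> d = c \<otimes> b" and 2: "c \<otimes> g = e \<otimes> d"
      using xy yz by (auto simp: frac_rel_def)
    have "d \<otimes> (a \<otimes> g) = (a \<otimes> d) \<otimes> g" using C by (simp add: m_ac)
    also have "\<dots> = b \<otimes> (c \<otimes> g)" unfolding 1 using C by (simp add: m_ac)
    also have "\<dots> = d \<otimes> (e \<otimes> b)" unfolding 2 using C by (simp add: m_ac)
    finally have "a \<otimes> g = e \<otimes> b" using C m_lcancel by simp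
    then show "(x, z) \<in> frac_rel R" using C by (simp add: frac_rel_def)
  qed
qed

lemma frac_eq_iff:
  assumes "a \<in> carrier R" "b \<in> carrier R" "b \<noteq> \<zero>" "c \<in> carrier R" "d \<in> carrier R" "d \<noteq> \<zero>"
  shows "mk_frac R a b = mk_frac R c d \<longleftrightarrow> a \<otimes> d = c \<otimes> b"
  using eq_equiv_class_iff[OF equiv_frac_rel, of "(a, b)" "(c, d)"] assms
  by (simp add: mk_frac_def frac_rel_def)

lemma frac_in_carrier [simp]:
  assumes "a \<in> carrier R" "b \<in> carrier R" "b \<noteq> \<zero>"
  shows "mk_frac R a b \<in> carrier (frac_field R)"
  using assms by (simp add: frac_field_def mk_frac_def quotientI)

lemma frac_cases:
  assumes "x \<in> carrier (frac_field R)"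
  obtains a b where "a \<in> carrier R" "b \<in> carrier R" "b \<noteq> \<zero>" "x = mk_frac R a b"
  using assms by (auto simp: frac_field_def mk_frac_def elim!: quotientE)

lemma frac_mult [simp]:
  assumes "a \<in> carrier R" "b \<in> carrier R" "b \<noteq> \<zero>" "c \<in> carrier R" "d \<in> carrier R" "d \<noteq> \<zero>"
  shows "mk_frac R a b \<otimes>\<^bsub>frac_field R\<^esub> mk_frac R c d = mk_frac R (a \<otimes> c) (b \<otimes> d)"
proof -
  have eq: "mk_frac R (a' \<otimes> c') (b' \<otimes> d') = mk_frac R (a \<otimes> c) (b \<otimes> d)"
    if "(a', b') \<in> mk_frac R a b" "(c', d') \<in> mk_frac R c d" for a' b' c' d'
  proof -
    have C: "a' \<in> carrier R" "b' \<in> carrier R" "c' \<in> carrier R" "d' \<in> carrier R" "b' \<noteq> \<zero>" "d' \<noteq> \<zero>"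
      and 1: "a \<otimes> b' = a' \<otimes> b" and 2: "c \<otimes> d' = c' \<otimes> d"
      using that by (auto simp: mk_frac_def frac_rel_def)
    have "(a \<otimes> c) \<otimes> (b' \<otimes> d') = (a \<otimes> b') \<otimes> (c \<otimes> d')" using C assms by (simp add: m_ac)
    also have "\<dots> = (a' \<otimes> c') \<otimes> (b \<otimes> d)" unfolding 1 2 using C assms by (simp add: m_ac)
    finally show ?thesis using C assms by (subst frac_eq_iff) (auto simp: integral_iff)
  qed
  have "(a, b) \<in> mk_frac R a b" "(c, d) \<in> mk_frac R c d"
    using assms by (auto simp: mk_frac_def frac_rel_def)
  from UN_pairs_const[OF this eq] show ?thesis by (simp add: frac_field_def)
qed

lemma frac_add [simp]:
  assumes "a \<in> carrier R" "b \<in> carrier R" "b \<noteq> \<zero>" "c \<in> carrier R" "d \<in> carrier R" "d \<noteq> \<zero>"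
  shows "mk_frac R a b \<oplus>\<^bsub>frac_field R\<^esub> mk_frac R c d = mk_frac R (a \<otimes> d \<oplus> c \<otimes> b) (b \<otimes> d)"
proof -
  have eq: "mk_frac R (a' \<otimes> d' \<oplus> c' \<otimes> b') (b' \<otimes> d') = mk_frac R (a \<otimes> d \<oplus> c \<otimes> b) (b \<otimes> d)"
    if "(a', b') \<in> mk_frac R a b" "(c', d') \<in> mk_frac R c d" for a' b' c' d'
  proof -
    have C: "a' \<in> carrier R" "b' \<in> carrier R" "c' \<in> carrier R" "d' \<in> carrier R" "b' \<noteq> \<zero>" "d' \<noteq> \<zero>"
      and 1: "a \<otimes> b' = a' \<otimes> b" and 2: "c \<otimes> d' = c' \<otimes> d"
      using that by (auto simp: mk_frac_def frac_rel_def)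
    have "(a \<otimes> d \<oplus> c \<otimes> b) \<otimes> (b' \<otimes> d') = (a \<otimes> b') \<otimes> (d \<otimes> d') \<oplus> (c \<otimes> d') \<otimes> (b \<otimes> b')"
      using C assms by (simp add: m_ac l_distr r_distr)
    also have "\<dots> = (a' \<otimes> d' \<oplus> c' \<otimes> b') \<otimes> (b \<otimes> d)"
      unfolding 1 2 using C assms by (simp add: m_ac l_distr r_distr)
    finally show ?thesis using C assms by (subst frac_eq_iff) (auto simp: integral_iff)
  qed
  have "(a, b) \<in> mk_frac R a b" "(c, d) \<in> mk_frac R c d"
    using assms by (auto simp: mk_frac_def frac_rel_def)
  from UN_pairs_const[OF this eq] show ?thesis by (simp add: frac_field_def)
qed

lemma frac_one: "\<one>\<^bsub>frac_field R\<^esub> = mk_frac R \<one> \<one>"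
  and frac_zero: "\<zero>\<^bsub>frac_field R\<^esub> = mk_frac R \<zero> \<one>"
  by (simp_all add: frac_field_def)

lemma field_frac_field: "field (frac_field R)"
proof (rule cring.cring_fieldI2)
  show "cring (frac_field R)"
  proof (rule cringI)
    show "abelian_group (frac_field R)"
    proof (rule abelian_groupI)
      fix x assume x: "x \<in> carrier (frac_field R)"
      from x obtain a b where
        ab: "a \<in> carrier R" "b \<in> carrier R" "b \<noteq> \<zero>" "x = mk_frac R a b"
        by (rule frac_cases)
      show "\<zero>\<^bsub>frac_field R\<^esub> \<oplus>\<^bsub>frac_field R\<^esub> x = x"
        using ab by (simp add: frac_zero)
      have "mk_frac R (\<ominus> a) b \<oplus>\<^bsub>frac_field R\<^esub> x = \<zero>\<^bsub>frac_field R\<^esub>"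
        using ab by (simp add: frac_zero frac_eq_iff integral_iff l_minus l_neg)
      then show "\<exists>y\<in>carrier (frac_field R). y \<oplus>\<^bsub>frac_field R\<^esub> x = \<zero>\<^bsub>frac_field R\<^esub>"
        using ab by (intro bexI[of _ "mk_frac R (\<ominus> a) b"]) auto
      fix y assume "y \<in> carrier (frac_field R)"
      then obtain c d where cd: "c \<in> carrier R" "d \<in> carrier R" "d \<noteq> \<zero>" "y = mk_frac R c d"
        by (rule frac_cases)
      show "x \<oplus>\<^bsub>frac_field R\<^esub> y \<in> carrier (frac_field R)"
        using ab cd by (simp add: integral_iff)
      show "x \<oplus>\<^bsub>frac_field R\<^esub> y = y \<oplus>\<^bsub>frac_field R\<^esub> x"
        using ab cd by (simp add: m_comm a_comm)
      fix z assume "z \<in> carrier (frac_field R)"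
      then obtain e g where eg: "e \<in> carrier R" "g \<in> carrier R" "g \<noteq> \<zero>" "z = mk_frac R e g"
        by (rule frac_cases)
      show "x \<oplus>\<^bsub>frac_field R\<^esub> y \<oplus>\<^bsub>frac_field R\<^esub> z = x \<oplus>\<^bsub>frac_field R\<^esub> (y \<oplus>\<^bsub>frac_field R\<^esub> z)"
        using ab cd eg by (simp add: integral_iff l_distr r_distr m_ac a_assoc)
    qed (simp add: frac_zero)
    show "Group.comm_monoid (frac_field R)"
    proof (rule comm_monoidI)
      fix x y assume x: "x \<in> carrier (frac_field R)" and y: "y \<in> carrier (frac_field R)"
      from x obtain a b where
        ab: "a \<in> carrier R" "b \<in> carrier R" "b \<noteq> \<zero>" "x = mk_frac R a b"
        by (rule frac_cases)
      from y obtain c d where cd: "c \<in> carrier R" "d \<in> carrier R" "d \<noteq> \<zero>" "y = mk_frac R c d"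
        by (rule frac_cases)
      show "x \<otimes>\<^bsub>frac_field R\<^esub> y \<in> carrier (frac_field R)"
        using ab cd by (simp add: integral_iff)
      show "x \<otimes>\<^bsub>frac_field R\<^esub> y = y \<otimes>\<^bsub>frac_field R\<^esub> x"
        using ab cd by (simp add: m_comm)
      fix z assume "z \<in> carrier (frac_field R)"
      then obtain e g where eg: "e \<in> carrier R" "g \<in> carrier R" "g \<noteq> \<zero>" "z = mk_frac R e g"
        by (rule frac_cases)
      show "x \<otimes>\<^bsub>frac_field R\<^esub> y \<otimes>\<^bsub>frac_field R\<^esub> z = x \<otimes>\<^bsub>frac_field R\<^esub> (y \<otimes>\<^bsub>frac_field R\<^esub> z)"
        using ab cd eg by (simp add: integral_iff m_assoc)
    next
      fix x assume "x \<in> carrier (frac_field R)"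
      then obtain a b where
        ab: "a \<in> carrier R" "b \<in> carrier R" "b \<noteq> \<zero>" "x = mk_frac R a b"
        by (rule frac_cases)
      show "\<one>\<^bsub>frac_field R\<^esub> \<otimes>\<^bsub>frac_field R\<^esub> x = x"
        using ab by (simp add: frac_one)
    qed (simp add: frac_one)
    fix x y z assume x: "x \<in> carrier (frac_field R)" and y: "y \<in> carrier (frac_field R)"
      and z: "z \<in> carrier (frac_field R)"
    from x obtain a b where ab: "a \<in> carrier R" "b \<in> carrier R" "b \<noteq> \<zero>" "x = mk_frac R a b"
      by (rule frac_cases)
    from y obtain c d where cd: "c \<in> carrier R" "d \<in> carrier R" "d \<noteq> \<zero>" "y = mk_frac R c d"
      by (rule frac_cases)
    from z obtain e g where eg: "e \<in> carrier R" "g \<in> carrier R" "g \<noteq> \<zero>" "z = mk_frac R e g"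
      by (rule frac_cases)
    have "((a \<otimes> d \<oplus> c \<otimes> b) \<otimes> e) \<otimes> ((b \<otimes> g) \<otimes> (d \<otimes> g)) =
          ((a \<otimes> e) \<otimes> (d \<otimes> g) \<oplus> (c \<otimes> e) \<otimes> (b \<otimes> g)) \<otimes> ((b \<otimes> d) \<otimes> g)"
      using ab cd eg by (simp add: l_distr r_distr m_ac)
    then show "(x \<oplus>\<^bsub>frac_field R\<^esub> y) \<otimes>\<^bsub>frac_field R\<^esub> z =
        x \<otimes>\<^bsub>frac_field R\<^esub> z \<oplus>\<^bsub>frac_field R\<^esub> y \<otimes>\<^bsub>frac_field R\<^esub> z"
      using ab cd eg by (simp add: integral_iff frac_eq_iff)
  qed
  show "\<zero>\<^bsub>frac_field R\<^esub> \<noteq> \<one>\<^bsub>frac_field R\<^esub>"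
    by (simp add: frac_one frac_zero frac_eq_iff)
  fix x assume x: "x \<in> carrier (frac_field R)" "x \<noteq> \<zero>\<^bsub>frac_field R\<^esub>"
  from x(1) obtain a b where ab: "a \<in> carrier R" "b \<in> carrier R" "b \<noteq> \<zero>" "x = mk_frac R a b"
    by (rule frac_cases)
  with x(2) have "a \<noteq> \<zero>" by (auto simp: frac_zero frac_eq_iff)
  then show "\<exists>y\<in>carrier (frac_field R). x \<otimes>\<^bsub>frac_field R\<^esub> y = \<one>\<^bsub>frac_field R\<^esub>"
    using ab by (intro bexI[of _ "mk_frac R b a"]) (simp_all add: frac_one frac_eq_iff integral_iff m_comm)
qed

lemma frac_embed_hom: "frac_embed R \<in> ring_hom R (frac_field R)"
  by (rule ring_hom_memI) (simp_all add: frac_embed_def frac_one)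

lemma inj_on_frac_embed: "inj_on (frac_embed R) (carrier R)"
  by (rule inj_onI) (simp add: frac_embed_def frac_eq_iff)

end

section \<open>Normal domains\<close>

text \<open>Polynomials are coefficient lists with the leading coefficient first.\<close>

definition integral_over :: "('a, 'b) ring_scheme \<Rightarrow> 'a set \<Rightarrow> 'a \<Rightarrow> bool" where
  "integral_over K S x \<longleftrightarrow>
     (\<exists>p. polynomial\<^bsub>K\<^esub> S p \<and> p \<noteq> [] \<and> lead_coeff p = \<one>\<^bsub>K\<^esub> \<and> ring.eval K p x = \<zero>\<^bsub>K\<^esub>)"

locale normal_domain = domain D for D (structure) +
  assumes integrally_closed:
    "\<And>x. \<lbrakk>x \<in> carrier (frac_field D); integral_over (frac_field D) (frac_embed D ` carrier D) x\<rbrakk>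
      \<Longrightarrow> x \<in> frac_embed D ` carrier D"

section \<open>Matrices and principal minors\<close>

text \<open>
  Matrices have rows and columns indexed by the same finite set \<open>I\<close>; an \<open>n \<times> n\<close>-matrix is one
  with \<open>I = {1..n}\<close>. They are extensional functions of the index pair, so that equality of matrices
  is equality of functions.
\<close>

definition mat_ring :: "('a, 'b) ring_scheme \<Rightarrow> nat set \<Rightarrow> (nat \<times> nat \<Rightarrow> 'a) ring" where
  "mat_ring R I =
    \<lparr>carrier = I \<times> I \<rightarrow>\<^sub>E carrier R,
     mult = (\<lambda>A B. \<lambda>(i, j)\<in>I \<times> I. \<Oplus>\<^bsub>R\<^esub>k\<in>I. A (i, k) \<otimes>\<^bsub>R\<^esub> B (k, j)),
     one = (\<lambda>(i, j)\<in>I \<times> I. if i = j then \<one>\<^bsub>R\<^esub> else \<zero>\<^bsub>R\<^esub>),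
     zero = (\<lambda>_\<in>I \<times> I. \<zero>\<^bsub>R\<^esub>),
     add = (\<lambda>A B. \<lambda>(i, j)\<in>I \<times> I. A (i, j) \<oplus>\<^bsub>R\<^esub> B (i, j))\<rparr>"

definition principal_submat :: "(nat \<times> nat \<Rightarrow> 'a) \<Rightarrow> nat set \<Rightarrow> (nat \<times> nat \<Rightarrow> 'a)" where
  "principal_submat A S = restrict A (S \<times> S)"

text \<open>
  The Leibniz formula, taken directly over the index set: renumbering the rows and columns of \<open>A\<^sub>S\<close>
  increasingly as \<open>1, \<dots>, |S|\<close> conjugates the permutations and does not change their sign.
  For \<open>I = {}\<close> the value is \<open>1\<close>.
\<close>

definition mat_det :: "('a, 'b) ring_scheme \<Rightarrow> nat set \<Rightarrow> (nat \<times> nat \<Rightarrow> 'a) \<Rightarrow> 'a" where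
  "mat_det R I A =
    (\<Oplus>\<^bsub>R\<^esub>p\<in>{p. p permutes I}.
       (if evenperm p then \<one>\<^bsub>R\<^esub> else \<ominus>\<^bsub>R\<^esub> \<one>\<^bsub>R\<^esub>) \<otimes>\<^bsub>R\<^esub> (\<Otimes>\<^bsub>R\<^esub>i\<in>I. A (i, p i)))"

definition one_principled :: "('a, 'b) ring_scheme \<Rightarrow> nat \<Rightarrow> (nat \<times> nat \<Rightarrow> 'a) \<Rightarrow> bool" where
  "one_principled R n A \<longleftrightarrow>
     A \<in> carrier (mat_ring R {1..n}) \<and>
     (\<forall>S \<subseteq> {1..n}. mat_det R S (principal_submat A S) = \<one>\<^bsub>R\<^esub>)"

lemma (in cring) finsum_swap:
  assumes "finite I" "finite J" "\<And>i j. i \<in> I \<Longrightarrow> j \<in> J \<Longrightarrow> g i j \<in> carrier R"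
  shows "(\<Oplus>i\<in>I. \<Oplus>j\<in>J. g i j) = (\<Oplus>j\<in>J. \<Oplus>i\<in>I. g i j)"
  using assms(1,3)
proof (induction I rule: finite_induct)
  case (insert i I)
  then have "(\<Oplus>k\<in>insert i I. \<Oplus>j\<in>J. g k j) = (\<Oplus>j\<in>J. g i j) \<oplus> (\<Oplus>j\<in>J. \<Oplus>i\<in>I. g i j)"
    by (simp add: Pi_def)
  also have "\<dots> = (\<Oplus>j\<in>J. g i j \<oplus> (\<Oplus>i\<in>I. g i j))"
    using insert by (intro finsum_addf[symmetric]) (auto simp: Pi_def)
  also have "\<dots> = (\<Oplus>j\<in>J. \<Oplus>i\<in>insert i I. g i j)"
    using insert by (intro finsum_cong') (auto simp: Pi_def)
  finally show ?case .
qed simp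

lemma mat_eqI:
  assumes "A \<in> carrier (mat_ring R I)" "B \<in> carrier (mat_ring R I)"
    and "\<And>i j. i \<in> I \<Longrightarrow> j \<in> I \<Longrightarrow> A (i, j) = B (i, j)"
  shows "A = B"
  using assms by (intro PiE_ext[where k = "I \<times> I" and s = "\<lambda>_. carrier R"]) (auto simp: mat_ring_def)

lemma mat_entry_closed [simp]:
  "A \<in> carrier (mat_ring R I) \<Longrightarrow> i \<in> I \<Longrightarrow> j \<in> I \<Longrightarrow> A (i, j) \<in> carrier R"
  by (auto simp: mat_ring_def)

lemma mat_entry:
  assumes "i \<in> I" "j \<in> I"
  shows mat_mult_entry: "(A \<otimes>\<^bsub>mat_ring R I\<^esub> B) (i, j) = (\<Oplus>\<^bsub>R\<^esub>k\<in>I. A (i, k) \<otimes>\<^bsub>R\<^esub> B (k, j))"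
    and mat_add_entry: "(A \<oplus>\<^bsub>mat_ring R I\<^esub> B) (i, j) = A (i, j) \<oplus>\<^bsub>R\<^esub> B (i, j)"
    and mat_one_entry: "\<one>\<^bsub>mat_ring R I\<^esub> (i, j) = (if i = j then \<one>\<^bsub>R\<^esub> else \<zero>\<^bsub>R\<^esub>)"
    and mat_zero_entry: "\<zero>\<^bsub>mat_ring R I\<^esub> (i, j) = \<zero>\<^bsub>R\<^esub>"
  using assms by (simp_all add: mat_ring_def)

lemma (in cring) mat_closed [simp]:
  shows "A \<in> carrier (mat_ring R I) \<Longrightarrow> B \<in> carrier (mat_ring R I) \<Longrightarrow>
      A \<otimes>\<^bsub>mat_ring R I\<^esub> B \<in> carrier (mat_ring R I)"
    and "A \<in> carrier (mat_ring R I) \<Longrightarrow> B \<in> carrier (mat_ring R I) \<Longrightarrow>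
      A \<oplus>\<^bsub>mat_ring R I\<^esub> B \<in> carrier (mat_ring R I)"
    and "\<one>\<^bsub>mat_ring R I\<^esub> \<in> carrier (mat_ring R I)"
    and "\<zero>\<^bsub>mat_ring R I\<^esub> \<in> carrier (mat_ring R I)"
  by (auto simp: mat_ring_def intro!: finsum_closed)

lemma (in cring) ring_mat_ring:
  assumes I: "finite I"
  shows "ring (mat_ring R I)"
proof (rule ringI)
  let ?M = "mat_ring R I"
  show "abelian_group ?M"
  proof (rule abelian_groupI)
    fix A assume A: "A \<in> carrier ?M"
    define B where "B = (\<lambda>(i, j)\<in>I \<times> I. \<ominus> A (i, j))"
    have B: "B \<in> carrier ?M" using A by (auto simp: B_def mat_ring_def)
    have "B \<oplus>\<^bsub>?M\<^esub> A = \<zero>\<^bsub>?M\<^esub>"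
      using A B by (intro mat_eqI[where R = R and I = I]) (simp_all add: mat_entry, simp add: B_def l_neg)
    with B show "\<exists>B\<in>carrier ?M. B \<oplus>\<^bsub>?M\<^esub> A = \<zero>\<^bsub>?M\<^esub>" by blast
    show "\<zero>\<^bsub>?M\<^esub> \<oplus>\<^bsub>?M\<^esub> A = A"
      using A by (intro mat_eqI[where R = R and I = I]) (simp_all add: mat_entry)
    fix B assume B: "B \<in> carrier ?M"
    show "A \<oplus>\<^bsub>?M\<^esub> B = B \<oplus>\<^bsub>?M\<^esub> A"
      using A B by (intro mat_eqI[where R = R and I = I]) (simp_all add: mat_entry a_comm)
    fix C assume C: "C \<in> carrier ?M"
    show "A \<oplus>\<^bsub>?M\<^esub> B \<oplus>\<^bsub>?M\<^esub> C = A \<oplus>\<^bsub>?M\<^esub> (B \<oplus>\<^bsub>?M\<^esub> C)"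
      using A B C by (intro mat_eqI[where R = R and I = I]) (simp_all add: mat_entry a_assoc)
  qed simp_all
  show "Group.monoid ?M"
  proof (rule monoidI)
    fix A B C assume A: "A \<in> carrier ?M" and B: "B \<in> carrier ?M" and C: "C \<in> carrier ?M"
    have "(\<Oplus>k\<in>I. (\<Oplus>l\<in>I. A (i, l) \<otimes> B (l, k)) \<otimes> C (k, j)) =
          (\<Oplus>l\<in>I. A (i, l) \<otimes> (\<Oplus>k\<in>I. B (l, k) \<otimes> C (k, j)))" if "i \<in> I" "j \<in> I" for i j
    proof -
      have "(\<Oplus>k\<in>I. (\<Oplus>l\<in>I. A (i, l) \<otimes> B (l, k)) \<otimes> C (k, j)) =
            (\<Oplus>k\<in>I. \<Oplus>l\<in>I. A (i, l) \<otimes> B (l, k) \<otimes> C (k, j))"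
        using that I A B C by (intro finsum_cong') (simp_all add: finsum_ldistr Pi_def)
      also have "\<dots> = (\<Oplus>l\<in>I. \<Oplus>k\<in>I. A (i, l) \<otimes> B (l, k) \<otimes> C (k, j))"
        using that I A B C by (intro finsum_swap) simp_all
      also have "\<dots> = (\<Oplus>l\<in>I. A (i, l) \<otimes> (\<Oplus>k\<in>I. B (l, k) \<otimes> C (k, j)))"
      proof (intro finsum_cong' refl)
        fix l assume "l \<in> I"
        then show "(\<Oplus>k\<in>I. A (i, l) \<otimes> B (l, k) \<otimes> C (k, j)) =
            A (i, l) \<otimes> (\<Oplus>k\<in>I. B (l, k) \<otimes> C (k, j))"
          using that I A B C
          by (subst finsum_rdistr) (auto simp: Pi_def m_assoc intro!: finsum_cong')
      qed (use that A B C in \<open>simp add: Pi_def\<close>)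
      finally show ?thesis .
    qed
    then show "A \<otimes>\<^bsub>?M\<^esub> B \<otimes>\<^bsub>?M\<^esub> C = A \<otimes>\<^bsub>?M\<^esub> (B \<otimes>\<^bsub>?M\<^esub> C)"
      using A B C
      by (intro mat_eqI[where R = R and I = I]) (simp_all add: mat_entry Pi_def cong: finsum_cong)
  next
    fix A assume A: "A \<in> carrier ?M"
    have "(\<Oplus>k\<in>I. (if i = k then \<one> else \<zero>) \<otimes> A (k, j)) = A (i, j)" if "i \<in> I" "j \<in> I" for i j
    proof -
      have "(\<Oplus>k\<in>I. (if i = k then \<one> else \<zero>) \<otimes> A (k, j)) = (\<Oplus>k\<in>I. if i = k then A (k, j) else \<zero>)"
        using that A by (intro finsum_cong') auto
      then show ?thesis using that A I by (simp add: finsum_singleton Pi_def)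
    qed
    then show "\<one>\<^bsub>?M\<^esub> \<otimes>\<^bsub>?M\<^esub> A = A"
      using A
      by (intro mat_eqI[where R = R and I = I]) (simp_all add: mat_entry Pi_def cong: finsum_cong)
    have "(\<Oplus>k\<in>I. A (i, k) \<otimes> (if k = j then \<one> else \<zero>)) = A (i, j)" if "i \<in> I" "j \<in> I" for i j
    proof -
      have "(\<Oplus>k\<in>I. A (i, k) \<otimes> (if k = j then \<one> else \<zero>)) = (\<Oplus>k\<in>I. if j = k then A (i, k) else \<zero>)"
        using that A by (intro finsum_cong') auto
      then show ?thesis using that A I by (simp add: finsum_singleton Pi_def)
    qed
    then show "A \<otimes>\<^bsub>?M\<^esub> \<one>\<^bsub>?M\<^esub> = A"
      using A
      by (intro mat_eqI[where R = R and I = I]) (simp_all add: mat_entry Pi_def cong: finsum_cong)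
  qed simp_all
  fix A B C assume A: "A \<in> carrier ?M" and B: "B \<in> carrier ?M" and C: "C \<in> carrier ?M"
  show "(A \<oplus>\<^bsub>?M\<^esub> B) \<otimes>\<^bsub>?M\<^esub> C = A \<otimes>\<^bsub>?M\<^esub> C \<oplus>\<^bsub>?M\<^esub> B \<otimes>\<^bsub>?M\<^esub> C"
    using A B C
    by (intro mat_eqI[where R = R and I = I])
      (simp_all add: mat_entry Pi_def l_distr finsum_addf cong: finsum_cong)
  show "C \<otimes>\<^bsub>?M\<^esub> (A \<oplus>\<^bsub>?M\<^esub> B) = C \<otimes>\<^bsub>?M\<^esub> A \<oplus>\<^bsub>?M\<^esub> C \<otimes>\<^bsub>?M\<^esub> B"
    using A B C
    by (intro mat_eqI[where R = R and I = I])
      (simp_all add: mat_entry Pi_def r_distr finsum_addf cong: finsum_cong)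
qed

end

theory Submission
  imports Defs "HOL-Combinatorics.Cycles"
begin

text \<open>
  Call the product of the entries \<open>A (i, p i)\<close> over the points of a cycle \<open>p\<close> of length at least two
  a cycle product of \<open>A\<close>. Over a domain, an easy induction shows that all cycle products of a
  1-principled matrix vanish, and the matrix is then unitriangular up to a renumbering. Over
  \<open>D / f D\<close> there are zero divisors, but two facts survive.

  First, the cycle products still vanish. This is the step where normality enters. Lift \<open>A\<close> to \<open>D\<close>
  and assume that the cycle products on all proper subsets of an index set \<open>S\<close> are divisible by \<open>f\<close>.
  Let \<open>x\<^sub>p\<close> be the product along a permutation \<open>p\<close> of \<open>S\<close>. If \<open>p \<noteq> p'\<close>, then the arrows of \<open>p\<close> and
  \<open>p'\<close> together contain two arrow-disjoint cycles that miss some point of \<open>S\<close>, so \<open>x\<^sub>p x\<^sub>p\<^sub>'\<close> is a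
  multiple of \<open>f\<^sup>2\<close> (\<open>square_divides_prod_of_two_cycle_products\<close>). The condition on the principal minor
  of \<open>S\<close> says that a signed sum of the \<open>x\<^sub>p\<close> is a multiple of \<open>f\<close>. Multiplying by \<open>x\<^sub>p\<close> gives
  \<open>x\<^sub>p\<^sup>2 \<in> f x\<^sub>p D + f\<^sup>2 D\<close>, that is, \<open>x\<^sub>p / f\<close> is integral over \<open>D\<close>. Hence it lies in \<open>D\<close>
  (\<open>divides_cycle_products\<close>).

  Second, vanishing cycle products are enough to imitate the group of unitriangular matrices. Let
  \<open>J\<^sub>k(i, j)\<close> be the ideal generated by the weights of all walks from \<open>i\<close> to \<open>j\<close> with at least \<open>k\<close>
  steps, the weight being the product of the off-diagonal entries along the walk. Then
  \<open>J\<^sub>k(i, j) J\<^sub>l(j, m)\<close> is contained in \<open>J\<^sub>k\<^sub>+\<^sub>l(i, m)\<close>. A walk that repeats a vertex contains a cycle,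
  so \<open>J\<^sub>1(i, i) = 0\<close>, and \<open>J\<^sub>k(i, j) = 0\<close> once \<open>k\<close> is at least the size of the matrix. The matrices with
  diagonal \<open>1\<close> and \<open>(i, j)\<close> entry in \<open>J\<^sub>1(i, j)\<close> for \<open>i \<noteq> j\<close> are therefore closed under products and
  inverses (\<open>walk_unipotent_mult\<close>, \<open>walk_unipotent_inverse\<close>), and all of them are 1-principled, since
  the Leibniz formula leaves only the term of the identity (\<open>mat_det_walk_unipotent\<close>). The matrix \<open>A\<close>
  is one of them, and so are its powers.
\<close>

section \<open>Two permutations and their shortcuts\<close>

text \<open>
  Redirecting the arrow of \<open>p\<close> at \<open>i\<close> to a new target \<open>a\<close>, one follows \<open>p\<close> from \<open>a\<close>. Either this
  never meets \<open>i\<close>, and then the orbit of \<open>a\<close> is a cycle of \<open>p\<close> that misses \<open>i\<close>. Or it arrives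
  at \<open>i\<close>, and the redirected arrow closes the path to a cycle through \<open>i\<close>; this cycle does
  not reach the old target \<open>p i\<close>, so it is strictly shorter than the whole set.
\<close>
lemma bij_betw_redirect:
  assumes "finite S" and p: "bij_betw p S S" and i: "i \<in> S" and a: "a \<in> S" and "a \<noteq> p i"
  obtains (avoid) T where "T \<subseteq> S" "a \<in> T" "i \<notin> T" "bij_betw p T T"
    | (shortcut) T where "T \<subset> S" "i \<in> T" "bij_betw (p(i := a)) T T"
proof (cases "\<exists>m. (p ^^ m) a = i")
  case False
  define T where "T = range (\<lambda>m. (p ^^ m) a)"
  have "(p ^^ m) a \<in> S" for m
    using a p by (induction m) (auto simp: bij_betw_def)
  then have TS: "T \<subseteq> S" by (auto simp: T_def)
  have "p ` T \<subseteq> T"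
  proof
    fix y assume "y \<in> p ` T"
    then obtain m where "y = p ((p ^^ m) a)" by (auto simp: T_def)
    then have "y = (p ^^ Suc m) a" by simp
    then show "y \<in> T" unfolding T_def by blast
  qed
  moreover have "inj_on p T" using p TS by (auto simp: bij_betw_def intro: inj_on_subset)
  moreover have "finite T" using TS assms(1) by (rule finite_subset)
  ultimately have "bij_betw p T T" by (simp add: bij_betw_def endo_inj_surj)
  moreover have "a \<in> T" unfolding T_def by (rule range_eqI[of _ _ 0]) simp
  ultimately show thesis using False TS by (intro avoid[of T]) (auto simp: T_def)
next
  case True
  define k where "k = (LEAST m. (p ^^ m) a = i)"
  have k: "(p ^^ k) a = i" unfolding k_def using True by (rule LeastI_ex)
  have lt: "(p ^^ m) a \<noteq> i" if "m < k" for m using not_less_Least that unfolding k_def by blast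
  define T where "T = (\<lambda>m. (p ^^ m) a) ` {..k}"
  let ?q = "p(i := a)"
  have S: "(p ^^ m) a \<in> S" for m
    using a p by (induction m) (auto simp: bij_betw_def)
  have iT: "i \<in> T" using k by (auto simp: T_def)
  have step: "?q ((p ^^ m) a) = (p ^^ Suc m) a" if "m < k" for m using lt[OF that] by simp
  have sub: "?q ` T \<subseteq> T"
  proof
    fix y assume "y \<in> ?q ` T"
    then obtain m where m: "m \<le> k" "y = ?q ((p ^^ m) a)" by (auto simp: T_def)
    show "y \<in> T"
    proof (cases "m = k")
      case True
      then have "y = (p ^^ 0) a" using m k by simp
      then show ?thesis unfolding T_def by blast
    next
      case False
      then have "m < k" using m by simp
      then have "y = (p ^^ Suc m) a" "Suc m \<le> k" using m step by auto
      then show ?thesis unfolding T_def by blast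
    qed
  qed
  have sup: "T \<subseteq> ?q ` T"
  proof
    fix y assume "y \<in> T"
    then obtain m where m: "m \<le> k" "y = (p ^^ m) a" by (auto simp: T_def)
    show "y \<in> ?q ` T"
    proof (cases m)
      case 0
      then have "y = ?q i" using m by simp
      then show ?thesis using iT by blast
    next
      case (Suc l)
      then have "l < k" using m by simp
      then have "y = ?q ((p ^^ l) a)" using step m Suc by simp
      moreover have "(p ^^ l) a \<in> T" using \<open>l < k\<close> by (auto simp: T_def)
      ultimately show ?thesis by (rule image_eqI)
    qed
  qed
  have "p i \<notin> T"
  proof
    assume "p i \<in> T"
    then obtain m where m: "m \<le> k" "p i = (p ^^ m) a" by (auto simp: T_def)
    show False
    proof (cases m)
      case 0
      then show False using m assms by simp
    next
      case (Suc l)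
      then have "p i = p ((p ^^ l) a)" using m by simp
      then have "i = (p ^^ l) a" using p i S by (auto simp: bij_betw_def dest: inj_onD)
      then show False using lt[of l] m Suc by simp
    qed
  qed
  moreover have "p i \<in> S" using p i by (auto simp: bij_betw_def)
  moreover have "T \<subseteq> S" using S by (auto simp: T_def)
  ultimately have "T \<subset> S" by blast
  moreover have "?q ` T = T" using sub sup by blast
  then have "bij_betw ?q T T"
    by (auto simp: bij_betw_def T_def intro!: eq_card_imp_inj_on)
  ultimately show thesis using iT by (intro shortcut)
qed

lemma (in comm_monoid) finprod_Diff_subset:
  assumes "finite S" "T \<subseteq> S" "g \<in> S \<rightarrow> carrier G"
  shows "finprod G g S = finprod G g T \<otimes> finprod G g (S - T)"
proof -
  have "finprod G g (T \<union> (S - T)) = finprod G g T \<otimes> finprod G g (S - T)"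
    using assms finite_subset by (intro finprod_Un_disjoint) auto
  moreover have "T \<union> (S - T) = S" using assms by blast
  ultimately show ?thesis by simp
qed

lemma (in comm_monoid) divides_mult_mult:
  assumes "f divides x" "g divides y" "f \<in> carrier G" "g \<in> carrier G" "u \<in> carrier G"
  shows "f \<otimes> g divides x \<otimes> y \<otimes> u"
proof -
  obtain c d where "c \<in> carrier G" "x = f \<otimes> c" "d \<in> carrier G" "y = g \<otimes> d"
    using assms by (auto simp: factor_def)
  then show ?thesis using assms by (intro dividesI[of "c \<otimes> d \<otimes> u"]) (auto simp: m_ac)
qed

text \<open>
  At a point \<open>i\<close> where \<open>p\<close> and \<open>p'\<close> differ, redirect \<open>p\<close> to \<open>p' i\<close> and \<open>p'\<close> to \<open>p i\<close>. The first
  shortcut uses arrows of \<open>p\<close> away from \<open>i\<close> and the arrow of \<open>p'\<close> at \<open>i\<close>, the second one the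
  reverse. So they share no factor of the product, and each of them contributes one factor \<open>f\<close>. If
  a shortcut does not exist, then \<open>p\<close> or \<open>p'\<close> splits into two shorter permutations, which already
  give \<open>f \<otimes> f\<close>.
\<close>
lemma (in comm_monoid) square_divides_prod_of_two_cycle_products:
  assumes fin: "finite S" and f: "f \<in> carrier G" and b: "\<And>i j. i \<in> S \<Longrightarrow> j \<in> S \<Longrightarrow> b (i, j) \<in> carrier G"
    and short: "\<And>T q. \<lbrakk>T \<subset> S; T \<noteq> {}; bij_betw q T T\<rbrakk> \<Longrightarrow> f divides (\<Otimes>i\<in>T. b (i, q i))"
    and p: "bij_betw p S S" and p': "bij_betw p' S S" and i: "i \<in> S" "p i \<noteq> p' i"
  shows "f \<otimes> f divides (\<Otimes>i\<in>S. b (i, p i)) \<otimes> (\<Otimes>i\<in>S. b (i, p' i))"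
proof -
  have in_S: "q j \<in> S" if "bij_betw q S S" "j \<in> S" for q j using that by (auto simp: bij_betw_def)
  have closed: "(\<lambda>j. b (j, q j)) \<in> S \<rightarrow> carrier G" if "bij_betw q S S" for q
    using that b in_S by blast
  have split: "f \<otimes> f divides (\<Otimes>i\<in>S. b (i, q i))"
    if q: "bij_betw q S S" and T: "T \<subseteq> S" "bij_betw q T T" "x \<in> T" "y \<in> S - T" for q T x y
  proof -
    have "bij_betw q (S - T) (S - T)" using q T by (intro bij_betw_DiffI) auto
    then have "f divides (\<Otimes>i\<in>T. b (i, q i))" "f divides (\<Otimes>i\<in>S - T. b (i, q i))"
      using T by (auto intro!: short)
    then have "f \<otimes> f divides (\<Otimes>i\<in>T. b (i, q i)) \<otimes> (\<Otimes>i\<in>S - T. b (i, q i)) \<otimes> \<one>"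
      using f by (intro divides_mult_mult) auto
    moreover have "(\<Otimes>i\<in>T. b (i, q i)) \<in> carrier G" "(\<Otimes>i\<in>S - T. b (i, q i)) \<in> carrier G"
      using closed[OF q] T by (auto intro!: finprod_closed)
    ultimately show ?thesis
      using finprod_Diff_subset[OF fin \<open>T \<subseteq> S\<close> closed[OF q]] by simp
  qed
  have X: "(\<Otimes>i\<in>S. b (i, p i)) \<in> carrier G" "(\<Otimes>i\<in>S. b (i, p' i)) \<in> carrier G"
    using closed p p' by (auto intro!: finprod_closed)
  have ff: "f \<otimes> f \<in> carrier G" using f by simp
  have short_cut: "\<exists>U\<in>carrier G. \<exists>V\<in>carrier G. f divides b (i, a) \<otimes> U \<and>
      (\<Otimes>i\<in>S. b (i, q i)) = b (i, q i) \<otimes> U \<otimes> V"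
    if q: "bij_betw q S S" and T: "T \<subset> S" "i \<in> T" "bij_betw (q(i := a)) T T" and a: "a \<in> S"
    for q a T
  proof -
    let ?U = "\<Otimes>j\<in>T - {i}. b (j, q j)"
    let ?V = "\<Otimes>j\<in>S - T. b (j, q j)"
    have T': "finite T" "insert i (T - {i}) = T" using T fin finite_subset by auto
    have U: "?U \<in> carrier G" and V: "?V \<in> carrier G"
      using closed[OF q] T by (auto intro!: finprod_closed)
    have bq: "(\<lambda>j. b (j, q j)) \<in> T - {i} \<rightarrow> carrier G" using closed[OF q] T by auto
    have "(\<Otimes>j\<in>insert i (T - {i}). b (j, (q(i := a)) j)) =
        b (i, a) \<otimes> (\<Otimes>j\<in>T - {i}. b (j, (q(i := a)) j))"
      using T' bq b a i by (subst finprod_insert) (auto simp: Pi_def)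
    also have "(\<Otimes>j\<in>T - {i}. b (j, (q(i := a)) j)) = ?U"
      using bq by (intro finprod_cong') auto
    finally have "f divides b (i, a) \<otimes> ?U" using short[of T "q(i := a)"] T T' by auto
    have "(\<Otimes>j\<in>insert i (T - {i}). b (j, q j)) = b (i, q i) \<otimes> ?U"
      using T' bq b in_S[OF q] i by (subst finprod_insert) auto
    then have "(\<Otimes>i\<in>S. b (i, q i)) = b (i, q i) \<otimes> ?U \<otimes> ?V"
      using finprod_Diff_subset[OF fin _ closed[OF q], of T] T T' by simp
    with U V \<open>f divides b (i, a) \<otimes> ?U\<close> show ?thesis by blast
  qed
  show ?thesis
  proof (cases rule: bij_betw_redirect[OF fin p i(1) in_S[OF p' i(1)] i(2)[symmetric]])
    case (1 T)
    then have "f \<otimes> f divides (\<Otimes>i\<in>S. b (i, p i))" using split[OF p] i by blast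
    then show ?thesis using X ff by (simp add: divides_prod_r)
  next
    case (2 T)
    note T = this
    show ?thesis
    proof (cases rule: bij_betw_redirect[OF fin p' i(1) in_S[OF p i(1)] i(2)])
      case (1 T')
      then have "f \<otimes> f divides (\<Otimes>i\<in>S. b (i, p' i))" using split[OF p'] i by blast
      then show ?thesis using X ff by (simp add: divides_prod_l)
    next
      case (2 T')
      obtain U V where U: "U \<in> carrier G" "V \<in> carrier G" "f divides b (i, p' i) \<otimes> U"
        "(\<Otimes>i\<in>S. b (i, p i)) = b (i, p i) \<otimes> U \<otimes> V"
        using short_cut[OF p T in_S[OF p' i(1)]] by blast
      obtain U' V' where U': "U' \<in> carrier G" "V' \<in> carrier G" "f divides b (i, p i) \<otimes> U'"
        "(\<Otimes>i\<in>S. b (i, p' i)) = b (i, p' i) \<otimes> U' \<otimes> V'"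
        using short_cut[OF p' 2 in_S[OF p i(1)]] by blast
      have "b (i, p i) \<in> carrier G" "b (i, p' i) \<in> carrier G" using b i in_S p p' by auto
      then show ?thesis
        using divides_mult_mult[OF U(3) U'(3) f f, of "V \<otimes> V'"] U U' by (simp add: m_ac)
    qed
  qed
qed

section \<open>Cycle products of a matrix over a normal domain\<close>

text \<open>
  The hypothesis says that the fraction \<open>y = x / f\<close> satisfies the monic equation
  \<open>y\<^sup>2 - d y - e = 0\<close>, so normality puts \<open>y\<close> into \<open>D\<close>.
\<close>
lemma (in normal_domain) divides_if_quadratic:
  assumes D: "x \<in> carrier D" "f \<in> carrier D" "d \<in> carrier D" "e \<in> carrier D" and "f \<noteq> \<zero>"
    and eq: "x \<otimes> x = f \<otimes> d \<otimes> x \<oplus> f \<otimes> f \<otimes> e"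
  shows "f divides x"
proof -
  let ?K = "frac_field D" and ?y = "mk_frac D x f"
  interpret K: field ?K by (rule field_frac_field)
  have y: "?y \<in> carrier ?K" using assms by simp
  let ?p = "[frac_embed D \<one>, frac_embed D (\<ominus> d), frac_embed D (\<ominus> e)]"
  have one: "frac_embed D \<one> = \<one>\<^bsub>?K\<^esub>" by (simp add: frac_embed_def frac_one)
  have num: "x \<otimes> x \<otimes> f \<oplus> (\<ominus> d \<otimes> x \<oplus> \<ominus> e \<otimes> f) \<otimes> (f \<otimes> f) = \<zero>"
    unfolding eq using D by algebra
  have "ring.eval ?K ?p ?y = \<zero>\<^bsub>?K\<^esub>"
    using D assms(5) y
    by (simp add: one numeral_2_eq_2)
      (simp add: one[symmetric] frac_embed_def frac_zero frac_eq_iff integral_iff num)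
  moreover have "polynomial\<^bsub>?K\<^esub> (frac_embed D ` carrier D) ?p"
    using D one by (auto simp: polynomial_def)
  ultimately have "integral_over ?K (frac_embed D ` carrier D) ?y"
    unfolding integral_over_def using one by (intro exI[of _ ?p]) simp
  then obtain c where "c \<in> carrier D" "?y = frac_embed D c"
    using integrally_closed[OF y] by blast
  then have "c \<in> carrier D" "x = f \<otimes> c"
    using D assms(5) by (simp_all add: frac_embed_def frac_eq_iff m_comm)
  then show ?thesis by (rule dividesI)
qed

definition off_diagonal :: "('a, 'b) ring_scheme \<Rightarrow> (nat \<times> nat \<Rightarrow> 'a) \<Rightarrow> (nat \<times> nat \<Rightarrow> 'a)" where
  "off_diagonal R A = (\<lambda>(i, j). if i = j then \<zero>\<^bsub>R\<^esub> else A (i, j))"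

lemma (in ring) finsum_in_ideal:
  assumes "ideal J R" "finite T" "\<And>x. x \<in> T \<Longrightarrow> g x \<in> J"
  shows "finsum R g T \<in> J"
proof -
  interpret J: ideal J R by fact
  show ?thesis using assms(2,3)
  proof (induction T rule: finite_induct)
    case (insert x T)
    then have "g \<in> T \<rightarrow> carrier R" "g x \<in> carrier R" using J.Icarr by auto
    then show ?case using insert by simp
  qed simp
qed

lemma (in cring) finprod_eq_zero:
  assumes "finite T" "g \<in> T \<rightarrow> carrier R" "x \<in> T" "g x = \<zero>"
  shows "finprod R g T = \<zero>"
proof -
  have "finprod R g (insert x (T - {x})) = \<zero>"
    using assms by (subst finprod_insert) (auto intro!: l_null finprod_closed)
  then show ?thesis using assms by (simp add: insert_absorb)
qed

lemma (in cring) divides_iff_in_cgenideal: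
  "f divides x \<longleftrightarrow> x \<in> PIdl f" if "f \<in> carrier R"
  using that by (auto simp: factor_def cgenideal_def m_comm)

lemma (in cring) finprod_moved:
  assumes "finite S" "\<And>i j. i \<in> S \<Longrightarrow> j \<in> S \<Longrightarrow> a (i, j) \<in> carrier R"
    and "\<And>i. i \<in> S \<Longrightarrow> a (i, i) = \<one>" and p: "p permutes S"
  shows "(\<Otimes>i\<in>S. a (i, p i)) = (\<Otimes>i\<in>{i. p i \<noteq> i}. off_diagonal R a (i, p i))"
proof -
  let ?T = "{i. p i \<noteq> i}"
  have T: "?T \<subseteq> S" using p by (auto simp: permutes_def)
  have c: "(\<lambda>i. a (i, p i)) \<in> S \<rightarrow> carrier R" using assms permutes_in_image[OF p] by auto
  have "(\<Otimes>i\<in>S. a (i, p i)) = (\<Otimes>i\<in>?T. a (i, p i)) \<otimes> (\<Otimes>i\<in>S - ?T. a (i, p i))"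
    using c T assms(1) by (intro finprod_Diff_subset)
  also have "(\<Otimes>i\<in>S - ?T. a (i, p i)) = (\<Otimes>i\<in>S - ?T. \<one>)"
    using assms(3) by (intro finprod_cong') auto
  also have "\<dots> = \<one>" by simp
  also have "(\<Otimes>i\<in>?T. a (i, p i)) = (\<Otimes>i\<in>?T. off_diagonal R a (i, p i))"
    using c T by (intro finprod_cong') (auto simp: off_diagonal_def)
  finally have "(\<Otimes>i\<in>S. a (i, p i)) = (\<Otimes>i\<in>?T. off_diagonal R a (i, p i)) \<otimes> \<one>" .
  moreover have "(\<Otimes>i\<in>?T. off_diagonal R a (i, p i)) \<in> carrier R"
    using c T by (intro finprod_closed) (auto simp: off_diagonal_def)
  ultimately show ?thesis by simp
qed

lemma permutes_moved: "p permutes S \<Longrightarrow> p permutes {i. p i \<noteq> i}"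
  by (auto simp: permutes_def)

text \<open>
  The heart of the argument, by induction on \<open>S\<close>. Assume that the cycle products on all smaller
  sets are divisible by \<open>f\<close>. In the determinant of the submatrix on \<open>S\<close>, the identity contributes
  \<open>1\<close>, and a permutation that moves some but not all points contributes a cycle product on a smaller
  set. Hence \<open>f\<close> divides the signed sum of the products over the fixed-point-free permutations of
  \<open>S\<close>. Multiplying this sum by one of its members \<open>x\<close> turns every other member into a multiple of
  \<open>f \<otimes> f\<close>, and what is left is a quadratic equation for \<open>x\<close> over \<open>f\<close>.
\<close>
lemma (in normal_domain) divides_cycle_products:
  assumes I: "finite I" and a: "\<And>i j. i \<in> I \<Longrightarrow> j \<in> I \<Longrightarrow> a (i, j) \<in> carrier D"
    and diag: "\<And>i. i \<in> I \<Longrightarrow> a (i, i) = \<one>"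
    and f: "f \<in> carrier D" "f \<noteq> \<zero>"
    and det: "\<And>S. S \<subseteq> I \<Longrightarrow> f divides (mat_det D S a \<ominus> \<one>)"
    and S: "S \<subseteq> I" "S \<noteq> {}" "bij_betw p S S"
  shows "f divides (\<Otimes>i\<in>S. off_diagonal D a (i, p i))"
proof -
  have "finite S" using S I finite_subset by blast
  then show ?thesis using S
  proof (induction S arbitrary: p rule: finite_psubset_induct)
    case (psubset S)
    define b where "b = off_diagonal D a"
    define w where "w p = (\<Otimes>i\<in>S. b (i, p i))" for p
    have aS: "a (i, j) \<in> carrier D" "a (i, i) = \<one>" if "i \<in> S" "j \<in> S" for i j
      using subsetD[OF psubset.prems(1)] that a diag by blast+
    have b: "b (i, j) \<in> carrier D" if "i \<in> S" "j \<in> S" for i j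
      using that aS by (auto simp: b_def off_diagonal_def)
    have short: "f divides (\<Otimes>i\<in>T. b (i, q i))" if "T \<subset> S" "T \<noteq> {}" "bij_betw q T T" for T q
      unfolding b_def using that psubset by blast
    have w: "w q \<in> carrier D" if "bij_betw q S S" for q
      unfolding w_def using bij_betwE[OF that] b by (intro finprod_closed) blast
    have ff: "f \<otimes> f \<in> carrier D" using f by simp
    have idf: "ideal (PIdl f) D" and idff: "ideal (PIdl (f \<otimes> f)) D"
      using f by (auto intro!: cgenideal_ideal)
    interpret J: ideal "PIdl f" D by fact
    interpret JJ: ideal "PIdl (f \<otimes> f)" D by fact
    have "f divides w p"
    proof (cases "\<exists>i\<in>S. p i = i")
      case True
      then obtain i where i: "i \<in> S" "p i = i" by blast
      have "w p = \<zero>" unfolding w_def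
      proof (rule finprod_eq_zero[OF \<open>finite S\<close> _ i(1)])
        show "(\<lambda>i. b (i, p i)) \<in> S \<rightarrow> carrier D"
          using bij_betwE[OF psubset.prems(3)] b by blast
      qed (simp add: i b_def off_diagonal_def)
      then show ?thesis using f by (intro dividesI[of \<zero>]) auto
    next
      case False
      \<comment> \<open>The determinant runs over permutations that are the identity outside \<open>S\<close>.\<close>
      define p0 where "p0 i = (if i \<in> S then p i else i)" for i
      have p0: "p0 permutes S"
        using psubset.prems(3) by (intro bij_imp_permutes) (auto simp: p0_def cong: bij_betw_cong)
      have wp0: "w p = w p0"
        unfolding w_def using b permutes_in_image[OF p0]
        by (intro finprod_cong') (auto simp: p0_def)
      let ?P = "{q. q permutes S}"
      define E where "E = {q. q permutes S \<and> (\<forall>i\<in>S. q i \<noteq> i)}"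
      define sg where "sg q = (if evenperm q then \<one> else \<ominus> \<one>)" for q :: "nat \<Rightarrow> nat"
      define t where "t q = sg q \<otimes> (\<Otimes>i\<in>S. a (i, q i))" for q
      have fin: "finite ?P" using \<open>finite S\<close> by (rule finite_permutations)
      then have finE: "finite E" by (rule rev_finite_subset) (auto simp: E_def)
      have p0E: "p0 \<in> E" using p0 False by (auto simp: E_def p0_def)
      have sg: "sg q \<in> carrier D" for q by (simp add: sg_def)
      have wq: "w q \<in> carrier D" if "q permutes S" for q using w permutes_imp_bij[OF that] .
      have prod_a: "(\<Otimes>i\<in>S. a (i, q i)) = (\<Otimes>i\<in>{i. q i \<noteq> i}. b (i, q i))" if "q permutes S" for q
        unfolding b_def using that \<open>finite S\<close> aS by (intro finprod_moved) auto
      have "(\<Otimes>i\<in>S. a (i, q i)) \<in> carrier D" if "q permutes S" for q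
        using aS permutes_in_image[OF that] by (intro finprod_closed) auto
      then have t: "t q \<in> carrier D" if "q permutes S" for q
        unfolding t_def using that sg by auto
      have tE: "t q = sg q \<otimes> w q" if "q \<in> E" for q
      proof -
        have "{i. q i \<noteq> i} = S" using that by (auto simp: E_def permutes_def)
        then show ?thesis using that prod_a[of q] by (simp add: t_def w_def E_def)
      qed
      have t_id: "t id = \<one>"
        using prod_a[OF permutes_id] by (simp add: t_def sg_def)
      have rest: "t q \<in> PIdl f" if q: "q \<in> ?P - E - {id}" for q
      proof -
        have "{i. q i \<noteq> i} \<subset> S" using q by (auto simp: E_def permutes_def)
        moreover have "{i. q i \<noteq> i} \<noteq> {}" using q by (auto simp: fun_eq_iff)
        moreover have "bij_betw q {i. q i \<noteq> i} {i. q i \<noteq> i}"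
          using q by (intro permutes_imp_bij permutes_moved) auto
        ultimately have "f divides (\<Otimes>i\<in>S. a (i, q i))" using prod_a[of q] q short by simp
        then show ?thesis
          using f sg by (auto simp: t_def divides_iff_in_cgenideal intro: J.I_l_closed)
      qed
      have id: "id \<in> ?P - E" using psubset.prems by (auto simp: E_def)
      have sumE: "finsum D t E \<in> PIdl f"
      proof -
        let ?r = "finsum D t (?P - E - {id})"
        have "mat_det D S a = finsum D t ?P"
          by (simp add: mat_det_def t_def[abs_def] sg_def)
        also have "\<dots> = finsum D t (E \<union> insert id (?P - E - {id}))"
          using id by (intro arg_cong[of _ _ "finsum D t"]) (auto simp: E_def)
        also have "\<dots> = finsum D t E \<oplus> finsum D t (insert id (?P - E - {id}))"
          using fin finE id t by (intro add.finprod_Un_disjoint) (auto simp: E_def)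
        also have "\<dots> = finsum D t E \<oplus> (\<one> \<oplus> ?r)"
          using fin t t_id id by (subst finsum_insert) auto
        finally have m: "mat_det D S a = finsum D t E \<oplus> (\<one> \<oplus> ?r)" .
        have r: "?r \<in> PIdl f" using fin rest by (intro finsum_in_ideal[OF idf]) auto
        have E: "finsum D t E \<in> carrier D" using t by (intro finsum_closed) (auto simp: E_def)
        have rc: "?r \<in> carrier D" using r J.Icarr by blast
        have alg: "u \<oplus> (\<one> \<oplus> v) \<ominus> \<one> = u \<oplus> v" "u \<oplus> v \<ominus> v = u"
          if "u \<in> carrier D" "v \<in> carrier D" for u v
          using that by algebra+
        have "mat_det D S a \<ominus> \<one> \<in> PIdl f"
          using det psubset.prems f divides_iff_in_cgenideal by blast
        moreover have "mat_det D S a \<ominus> \<one> = finsum D t E \<oplus> ?r"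
          unfolding m by (rule alg(1)[OF E rc])
        ultimately have "finsum D t E \<oplus> ?r \<ominus> ?r \<in> PIdl f"
          using r by (simp add: a_minus_def)
        moreover have "finsum D t E \<oplus> ?r \<ominus> ?r = finsum D t E" by (rule alg(2)[OF E rc])
        ultimately show ?thesis by simp
      qed
      \<comment> \<open>With \<open>s\<close> a multiple of \<open>f \<otimes> f\<close>, the signed sum over \<open>E\<close> times \<open>x\<close> is \<open>x\<^sup>2\<close> up to sign, plus \<open>s\<close>.\<close>
      let ?x = "w p0" and ?s = "finsum D (\<lambda>q. w p0 \<otimes> t q) (E - {p0})"
      have x: "?x \<in> carrier D" using wq p0 .
      have s: "?s \<in> PIdl (f \<otimes> f)"
      proof (intro finsum_in_ideal[OF idff])
        fix q assume q: "q \<in> E - {p0}"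
        then obtain i where "p0 i \<noteq> q i" by fastforce
        have qS: "q permutes S" using q by (simp add: E_def)
        have "i \<in> S"
          using \<open>p0 i \<noteq> q i\<close> permutes_not_in[OF p0] permutes_not_in[OF qS] by force
        then have "f \<otimes> f divides w p0 \<otimes> w q"
          unfolding w_def
          using \<open>p0 i \<noteq> q i\<close>
          by (intro square_divides_prod_of_two_cycle_products[OF \<open>finite S\<close> f(1) b short
                permutes_imp_bij[OF p0] permutes_imp_bij[OF qS]])
        then have "sg q \<otimes> (w p0 \<otimes> w q) \<in> PIdl (f \<otimes> f)"
          using ff sg by (simp add: divides_iff_in_cgenideal JJ.I_l_closed)
        moreover have "w p0 \<otimes> t q = sg q \<otimes> (w p0 \<otimes> w q)"
          using q x sg wq by (simp add: tE m_lcomm E_def)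
        ultimately show "w p0 \<otimes> t q \<in> PIdl (f \<otimes> f)" by simp
      qed (use finE in simp)
      have "?x \<otimes> finsum D t E = finsum D (\<lambda>q. ?x \<otimes> t q) E"
        using finE x t by (intro finsum_rdistr) (auto simp: E_def)
      also have "\<dots> = finsum D (\<lambda>q. ?x \<otimes> t q) (insert p0 (E - {p0}))"
        using p0E by (simp add: insert_absorb)
      also have "\<dots> = ?x \<otimes> (sg p0 \<otimes> ?x) \<oplus> ?s"
        using finE x t sg p0 p0E tE by (subst finsum_insert) (auto simp: E_def)
      finally have eq: "?x \<otimes> finsum D t E = ?x \<otimes> (sg p0 \<otimes> ?x) \<oplus> ?s" .
      obtain d where d: "d \<in> carrier D" "finsum D t E = d \<otimes> f"
        using sumE unfolding cgenideal_def by blast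
      obtain e where e: "e \<in> carrier D" "?s = e \<otimes> (f \<otimes> f)"
        using s unfolding cgenideal_def by blast
      have "?x \<otimes> (sg p0 \<otimes> ?x) = ?x \<otimes> finsum D t E \<ominus> ?s"
      proof -
        have alg: "u = u \<oplus> v \<ominus> v" if "u \<in> carrier D" "v \<in> carrier D" for u v
          using that by algebra
        show ?thesis unfolding eq using x sg e f by (intro alg) simp_all
      qed
      then have sq: "?x \<otimes> (sg p0 \<otimes> ?x) = ?x \<otimes> (d \<otimes> f) \<ominus> e \<otimes> (f \<otimes> f)"
        unfolding d e .
      have "f divides ?x"
      proof (rule divides_if_quadratic)
        have alg: "s \<otimes> (y \<otimes> (d \<otimes> f) \<ominus> e \<otimes> (f \<otimes> f)) = 
            f \<otimes> (s \<otimes> d) \<otimes> y \<oplus> f \<otimes> f \<otimes> (\<ominus> (s \<otimes> e))"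
          if "y \<in> carrier D" "s \<in> carrier D" for y s
          using that d(1) e(1) f(1) by algebra
        have "sg p0 \<otimes> sg p0 = \<one>" by (simp add: sg_def l_minus)
        moreover have "sg p0 \<otimes> (?x \<otimes> (sg p0 \<otimes> ?x)) = (sg p0 \<otimes> sg p0) \<otimes> (?x \<otimes> ?x)"
          using x sg by (simp add: m_ac)
        ultimately have "?x \<otimes> ?x = sg p0 \<otimes> (?x \<otimes> (sg p0 \<otimes> ?x))"
          using x by simp
        also have "\<dots> = f \<otimes> (sg p0 \<otimes> d) \<otimes> ?x \<oplus> f \<otimes> f \<otimes> (\<ominus> (sg p0 \<otimes> e))"
          unfolding sq by (rule alg[OF x sg])
        finally show "?x \<otimes> ?x = f \<otimes> (sg p0 \<otimes> d) \<otimes> ?x \<oplus> f \<otimes> f \<otimes> (\<ominus> (sg p0 \<otimes> e))" .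
      qed (use x sg d e f in auto)
      then show ?thesis using wp0 by simp
    qed
    then show ?case by (simp add: w_def b_def)
  qed
qed

section \<open>Walks in a matrix all of whose cycle products vanish\<close>

text \<open>
  A walk is the list of the vertices that it visits. A walk with a single vertex has no steps and
  weight \<open>1\<close>; the empty list gets the same weight as a default.
\<close>
fun walk_weight :: "('a, 'b) ring_scheme \<Rightarrow> (nat \<times> nat \<Rightarrow> 'a) \<Rightarrow> nat list \<Rightarrow> 'a" where
  "walk_weight R N (i # j # is) = N (i, j) \<otimes>\<^bsub>R\<^esub> walk_weight R N (j # is)"
| "walk_weight R N _ = \<one>\<^bsub>R\<^esub>"

text \<open>
  This lets an inclusion between products of generated ideals be checked on generators, one
  factor at a time.
\<close>
lemma (in cring) ideal_colon:
  assumes "ideal J R" and y: "y \<in> carrier R"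
  shows "ideal {z \<in> carrier R. z \<otimes> y \<in> J} R"
proof -
  interpret J: ideal J R by fact
  show ?thesis
  proof (rule idealI[OF ring_axioms])
    show "subgroup {z \<in> carrier R. z \<otimes> y \<in> J} (add_monoid R)"
    proof (rule add.subgroupI)
      have "\<zero> \<in> {z \<in> carrier R. z \<otimes> y \<in> J}" using y by simp
      then show "{z \<in> carrier R. z \<otimes> y \<in> J} \<noteq> {}" by blast
    qed (use y in \<open>auto simp: l_minus l_distr\<close>)
  next
    fix z x assume "z \<in> {z \<in> carrier R. z \<otimes> y \<in> J}" and x: "x \<in> carrier R"
    then have "x \<otimes> (z \<otimes> y) \<in> J" "z \<in> carrier R" by (auto intro: J.I_l_closed)
    then show "x \<otimes> z \<in> {z \<in> carrier R. z \<otimes> y \<in> J}" "z \<otimes> x \<in> {z \<in> carrier R. z \<otimes> y \<in> J}"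
      using x y by (simp_all add: m_ac)
  qed
qed

text \<open>
  The factors \<open>g i\<close> sit on the arrows of the permutation. An arrow \<open>i \<rightarrow> j\<close> and its successor
  \<open>j \<rightarrow> p j\<close> may be contracted to one arrow \<open>i \<rightarrow> p j\<close> that carries the product of the two factors.
  Each contraction removes a point, and in the end an arrow becomes a loop, whose factor is zero.
\<close>
lemma (in cring) finprod_zero_along_permutation:
  assumes J: "\<And>i j k x y. \<lbrakk>i \<in> S; j \<in> S; k \<in> S; x \<in> J i j; y \<in> J j k\<rbrakk> \<Longrightarrow> x \<otimes> y \<in> J i k"
    and closed: "\<And>i j. \<lbrakk>i \<in> S; j \<in> S\<rbrakk> \<Longrightarrow> J i j \<subseteq> carrier R"
    and loop: "\<And>i. i \<in> S \<Longrightarrow> J i i \<subseteq> {\<zero>}"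
    and "finite S" "S \<noteq> {}" "p permutes S" "\<And>i. i \<in> S \<Longrightarrow> g i \<in> J i (p i)"
  shows "finprod R g S = \<zero>"
  using assms(4,5,1-3,6-)
proof (induction S arbitrary: p g rule: finite_psubset_induct)
  case (psubset S)
  note J = psubset.prems(2) and closed = psubset.prems(3) and loop = psubset.prems(4)
    and p = psubset.prems(5) and g = psubset.prems(6)
  have pS: "p i \<in> S" if "i \<in> S" for i using that p by (simp add: permutes_in_image)
  have gR: "g i \<in> carrier R" if "i \<in> S" for i using closed g pS that by blast
  obtain i where i: "i \<in> S" using psubset.prems(1) by blast
  show ?case
  proof (cases "p i = i")
    case True
    then have "g i \<in> J i i" using g[OF i] by simp
    then have "g i = \<zero>" using loop[OF i] by blast
    then show ?thesis using gR i psubset.hyps by (intro finprod_eq_zero[of S g i]) auto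
  next
    case False
    define j where "j = p i"
    \<comment> \<open>Composing with the transposition cuts \<open>j\<close> out of its cycle: \<open>q i = p j\<close> and \<open>q j = j\<close>.\<close>
    define q where "q = Transposition.transpose j (p j) \<circ> p"
    define h where "h = g(i := g i \<otimes> g j)"
    let ?T = "S - {j}"
    have j: "j \<in> S" "i \<in> ?T" using False i pS by (auto simp: j_def)
    have "q permutes S" unfolding q_def
      using p j pS by (intro permutes_compose permutes_swap_id) auto
    then have q: "q permutes ?T"
      by (rule permutes_superset) (auto simp: q_def)
    have inj: "p x = p y \<longleftrightarrow> x = y" for x y using permutes_inj[OF p] by (auto dest: injD)
    have qi: "q i = p j" by (simp add: q_def j_def)
    have qx: "q x = p x" if "x \<in> ?T" "x \<noteq> i" for x
      using that inj by (auto simp: q_def j_def Transposition.transpose_def)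
    have "finprod R h ?T = \<zero>"
    proof (rule psubset.IH[of ?T q h])
      show "?T \<subset> S" "?T \<noteq> {}" using j by auto
      show "q permutes ?T" by fact
      fix x assume x: "x \<in> ?T"
      show "h x \<in> J x (q x)"
      proof (cases "x = i")
        case True
        have "g i \<in> J i j" "g j \<in> J j (p j)" using g i j by (auto simp: j_def)
        then have "g i \<otimes> g j \<in> J i (p j)" using J[OF i j(1) pS[OF j(1)]] by blast
        then show ?thesis using True qi by (simp add: h_def)
      next
        case False
        then show ?thesis using x qx g by (simp add: h_def)
      qed
    next
      fix i j k x y assume "i \<in> ?T" "j \<in> ?T" "k \<in> ?T" "x \<in> J i j" "y \<in> J j k"
      then show "x \<otimes> y \<in> J i k" using J[of i j k x y] by simp
    next
      fix i j assume "i \<in> ?T" "j \<in> ?T"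
      then show "J i j \<subseteq> carrier R" "J i i \<subseteq> {\<zero>}" using closed[of i j] loop[of i] by simp_all
    qed
    moreover have "finprod R g S = finprod R h ?T"
    proof -
      let ?r = "finprod R g (?T - {i})"
      have r: "?r \<in> carrier R" using gR by (intro finprod_closed) auto
      have "finprod R g (insert j ?T) = g j \<otimes> finprod R g ?T"
        using psubset.hyps gR j by (intro finprod_insert) auto
      moreover have "insert j ?T = S" using j by auto
      moreover have "finprod R g (insert i (?T - {i})) = g i \<otimes> ?r"
        using psubset.hyps gR i j by (intro finprod_insert) auto
      moreover have "finprod R h (insert i (?T - {i})) = g i \<otimes> g j \<otimes> finprod R h (?T - {i})"
        using psubset.hyps gR i j by (subst finprod_insert) (auto simp: h_def)
      moreover have "insert i (?T - {i}) = ?T" using j by auto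
      moreover have "finprod R h (?T - {i}) = ?r"
        using gR by (intro finprod_cong') (auto simp: h_def)
      ultimately show ?thesis using r gR i j by (simp add: m_ac)
    qed
    ultimately show ?thesis by simp
  qed
qed

text \<open>
  A permutation of \<open>S\<close> is a disjoint union of cycles, so this condition says that every cycle in the
  complete digraph on \<open>I\<close>, loops included, has weight zero.
\<close>
locale null_cycles = cring R for R (structure) +
  fixes I :: "nat set" and N :: "nat \<times> nat \<Rightarrow> 'a"
  assumes finite_I: "finite I"
    and entries_closed: "\<And>i j. \<lbrakk>i \<in> I; j \<in> I\<rbrakk> \<Longrightarrow> N (i, j) \<in> carrier R"
    and null_cycle: "\<And>S p. \<lbrakk>S \<subseteq> I; S \<noteq> {}; bij_betw p S S\<rbrakk> \<Longrightarrow> (\<Otimes>i\<in>S. N (i, p i)) = \<zero>"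
begin

abbreviation weight :: "nat list \<Rightarrow> 'a" where
  "weight \<equiv> walk_weight R N"

lemma weight_closed: "set xs \<subseteq> I \<Longrightarrow> weight xs \<in> carrier R"
  by (induction xs rule: induct_list012) (auto intro: entries_closed)

lemma weight_append:
  assumes "set (xs @ y # zs) \<subseteq> I"
  shows "weight (xs @ y # zs) = weight (xs @ [y]) \<otimes> weight (y # zs)"
  using assms
proof (induction xs)
  case Nil
  then show ?case using weight_closed by simp
next
  case (Cons x xs)
  have "weight (x # us) = N (x, hd us) \<otimes> weight us" if "us \<noteq> []" for us
    using that by (cases us) auto
  moreover have "hd (xs @ y # zs) = hd (xs @ [y])" by (cases xs) auto
  moreover have "hd (xs @ [y]) \<in> I" using Cons.prems by (cases xs) auto
  ultimately show ?case
    using Cons weight_closed entries_closed by (simp add: m_assoc)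
qed

lemma weight_eq_finprod:
  assumes "distinct xs" "set (xs @ [z]) \<subseteq> I" "map p xs = tl (xs @ [z])"
  shows "weight (xs @ [z]) = (\<Otimes>i\<in>set xs. N (i, p i))"
  using assms
proof (induction xs)
  case (Cons x xs)
  obtain us where us: "xs @ [z] = p x # us" "map p xs = us"
    using Cons.prems(3) by (cases "xs @ [z]") auto
  have "map p xs = tl (xs @ [z])" using us by simp
  then have IH: "weight (xs @ [z]) = (\<Otimes>i\<in>set xs. N (i, p i))" using Cons by simp
  have "set (map p (x # xs)) \<subseteq> I"
    using Cons.prems(2) by (subst Cons.prems(3)) auto
  then have p: "p i \<in> I" if "i \<in> set (x # xs)" for i using that by auto
  have "weight ((x # xs) @ [z]) = N (x, p x) \<otimes> weight (xs @ [z])" using us by simp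
  also have "\<dots> = (\<Otimes>i\<in>set (x # xs). N (i, p i))"
    using Cons.prems p entries_closed unfolding IH by (simp add: Pi_def subset_iff)
  finally show ?case .
qed simp

lemma weight_simple_cycle:
  assumes "distinct (y # ys)" "set (y # ys) \<subseteq> I"
  shows "weight (y # ys @ [y]) = \<zero>"
proof -
  let ?p = "cycle_of_list (y # ys)"
  have "map ?p (y # ys) = rotate1 (y # ys)"
    using cyclic_rotation[OF assms(1), of 1] by simp
  then have "weight ((y # ys) @ [y]) = (\<Otimes>i\<in>set (y # ys). N (i, ?p i))"
    using assms by (intro weight_eq_finprod) auto
  also have "\<dots> = \<zero>"
    using assms by (intro null_cycle permutes_imp_bij cycle_permutes) auto
  finally show ?thesis by simp
qed

text \<open>
  A walk that visits a vertex twice contains a closed walk, and a shortest closed walk inside it is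
  a simple cycle.
\<close>
lemma weight_not_distinct:
  assumes "\<not> distinct xs" "set xs \<subseteq> I"
  shows "weight xs = \<zero>"
  using assms
proof (induction xs rule: length_induct)
  case (1 xs)
  obtain us y ys zs where xs: "xs = us @ [y] @ ys @ [y] @ zs"
    using not_distinct_decomp[OF "1.prems"(1)] by blast
  have "weight (y # ys @ [y]) = \<zero>"
  proof (cases "distinct (y # ys)")
    case True
    then show ?thesis using weight_simple_cycle 1(3) xs by simp
  next
    case False
    then have "weight (y # ys) = \<zero>" using 1 xs by auto
    moreover have "weight (y # ys @ [y]) = weight ((y # ys) @ [y])" by simp
    ultimately show ?thesis
    proof (cases ys rule: rev_cases)
      case (snoc vs v)
      then show ?thesis
        using weight_append[of "y # vs" v "[y]"] \<open>weight (y # ys) = \<zero>\<close> 1(3) xs entries_closed by simp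
    qed (use False in simp)
  qed
  moreover have "weight xs = weight (us @ [y]) \<otimes> (weight (y # ys @ [y]) \<otimes> weight (y # zs))"
    using weight_append[of us y "ys @ y # zs"] weight_append[of "y # ys" y zs] 1(3) xs by simp
  ultimately show ?case using 1(3) xs weight_closed by simp
qed

text \<open>
  The walks from \<open>i\<close> to \<open>j\<close> with at least \<open>k\<close> steps. The lower bound on the length is what later
  makes matrices nilpotent: long walks repeat a vertex.
\<close>
definition walks :: "nat \<Rightarrow> nat \<Rightarrow> nat \<Rightarrow> nat list set" where
  "walks k i j = {xs. set xs \<subseteq> I \<and> k < length xs \<and> hd xs = i \<and> last xs = j}"

definition walk_ideal :: "nat \<Rightarrow> nat \<Rightarrow> nat \<Rightarrow> 'a set" where
  "walk_ideal k i j = Idl (weight ` walks k i j)"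

lemma weights_closed: "weight ` walks k i j \<subseteq> carrier R"
  using weight_closed by (auto simp: walks_def)

lemma ideal_walk_ideal: "ideal (walk_ideal k i j) R"
  unfolding walk_ideal_def by (rule genideal_ideal[OF weights_closed])

lemma weight_in_walk_ideal: "xs \<in> walks k i j \<Longrightarrow> weight xs \<in> walk_ideal k i j"
  unfolding walk_ideal_def using genideal_self[OF weights_closed] by blast

lemma entry_in_walk_ideal:
  assumes "i \<in> I" "j \<in> I"
  shows "N (i, j) \<in> walk_ideal 1 i j"
proof -
  have "[i, j] \<in> walks 1 i j" using assms by (simp add: walks_def)
  then show ?thesis using weight_in_walk_ideal[of "[i, j]"] entries_closed[OF assms] by simp
qed

lemma walk_ideal_minimal:
  "ideal J R \<Longrightarrow> (\<And>xs. xs \<in> walks k i j \<Longrightarrow> weight xs \<in> J) \<Longrightarrow> walk_ideal k i j \<subseteq> J"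
  unfolding walk_ideal_def by (intro genideal_minimal) auto

lemma walk_ideal_antimono: "k \<le> l \<Longrightarrow> walk_ideal l i j \<subseteq> walk_ideal k i j"
  by (intro walk_ideal_minimal ideal_walk_ideal weight_in_walk_ideal) (auto simp: walks_def)

lemma walk_ideal_closed: "walk_ideal k i j \<subseteq> carrier R"
  using ideal.Icarr[OF ideal_walk_ideal] by blast

text \<open>Concatenation of walks adds up the numbers of steps and multiplies the weights.\<close>
lemma walk_ideal_mult:
  assumes x: "x \<in> walk_ideal k i j" and y: "y \<in> walk_ideal l j m"
  shows "x \<otimes> y \<in> walk_ideal (k + l) i m"
proof -
  have weights: "weight xs \<otimes> weight ys \<in> walk_ideal (k + l) i m"
    if "xs \<in> walks k i j" "ys \<in> walks l j m" for xs ys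
  proof -
    have ne: "xs \<noteq> []" "ys \<noteq> []" using that by (auto simp: walks_def)
    have "last xs = j" "hd ys = j" using that by (simp_all add: walks_def)
    then obtain us vs where us: "xs = us @ [j]" and vs: "ys = j # vs"
      using append_butlast_last_id[OF ne(1)] list.collapse[OF ne(2)] by metis
    have "us @ j # vs \<in> walks (k + l) i m"
      using that unfolding us vs walks_def by (cases us) auto
    moreover have "weight (us @ j # vs) = weight xs \<otimes> weight ys"
      using that unfolding us vs walks_def by (intro weight_append) auto
    ultimately show ?thesis using weight_in_walk_ideal by metis
  qed
  have right: "z \<otimes> weight ys \<in> walk_ideal (k + l) i m"
    if "z \<in> walk_ideal k i j" "ys \<in> walks l j m" for z ys
  proof -
    have "weight ys \<in> carrier R" using that weights_closed by blast
    then have "walk_ideal k i j \<subseteq> {z \<in> carrier R. z \<otimes> weight ys \<in> walk_ideal (k + l) i m}"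
      using weights[OF _ that(2)] weights_closed
      by (intro walk_ideal_minimal ideal_colon ideal_walk_ideal) blast+
    then show ?thesis using that by blast
  qed
  have xR: "x \<in> carrier R" using x walk_ideal_closed by blast
  have "walk_ideal l j m \<subseteq> {z \<in> carrier R. z \<otimes> x \<in> walk_ideal (k + l) i m}"
  proof (intro walk_ideal_minimal ideal_colon ideal_walk_ideal xR)
    fix ys assume ys: "ys \<in> walks l j m"
    then have "weight ys \<in> carrier R" using weights_closed by blast
    then show "weight ys \<in> {z \<in> carrier R. z \<otimes> x \<in> walk_ideal (k + l) i m}"
      using right[OF x ys] xR by (simp add: m_comm)
  qed
  then have "y \<otimes> x \<in> walk_ideal (k + l) i m" "y \<in> carrier R" using y by auto
  then show ?thesis using xR by (simp add: m_comm)
qed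

lemma walk_ideal_eq_zero:
  assumes "\<And>xs. xs \<in> walks k i j \<Longrightarrow> \<not> distinct xs"
  shows "walk_ideal k i j \<subseteq> {\<zero>}"
  using assms weight_not_distinct by (intro walk_ideal_minimal zeroideal) (auto simp: walks_def)

lemma walk_ideal_loop: "walk_ideal 1 i i \<subseteq> {\<zero>}"
proof (intro walk_ideal_eq_zero)
  fix xs assume "xs \<in> walks 1 i i"
  then have "Suc 0 < length xs" "hd xs = last xs" by (auto simp: walks_def)
  then show "\<not> distinct xs" by (cases xs) (auto split: if_splits)
qed

lemma walk_ideal_long: "card I \<le> k \<Longrightarrow> walk_ideal k i j \<subseteq> {\<zero>}"
proof (intro walk_ideal_eq_zero notI)
  fix xs assume "card I \<le> k" "xs \<in> walks k i j" "distinct xs"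
  then have "card I < card (set xs)" "set xs \<subseteq> I" by (auto simp: walks_def distinct_card)
  then show False using card_mono[OF finite_I, of "set xs"] by simp
qed

section \<open>The group of walk-unipotent matrices\<close>

text \<open>
  These matrices play the role of the unipotent upper triangular ones. Over a domain a matrix with
  null cycles becomes triangular after a renumbering, because the nonzero entries form an acyclic
  digraph. With zero divisors no such order of the indices need exist, and membership of the
  \<open>(i, j)\<close> entry in the ideal of walk weights from \<open>i\<close> to \<open>j\<close> replaces it.
\<close>
definition walk_unipotent :: "(nat \<times> nat \<Rightarrow> 'a) \<Rightarrow> bool" where
  "walk_unipotent B \<longleftrightarrow> B \<in> carrier (mat_ring R I) \<and> (\<forall>i\<in>I. B (i, i) = \<one>) \<and>
     (\<forall>i\<in>I. \<forall>j\<in>I. i \<noteq> j \<longrightarrow> B (i, j) \<in> walk_ideal 1 i j)"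

definition walk_filtered :: "nat \<Rightarrow> (nat \<times> nat \<Rightarrow> 'a) \<Rightarrow> bool" where
  "walk_filtered k P \<longleftrightarrow> P \<in> carrier (mat_ring R I) \<and> (\<forall>i\<in>I. \<forall>j\<in>I. P (i, j) \<in> walk_ideal k i j)"

text \<open>
  Each permutation other than the identity picks entries along a nontrivial cycle, and their
  product lies in an ideal of closed walks, which is zero.
\<close>
lemma mat_det_walk_unipotent:
  assumes B: "walk_unipotent B" and S: "S \<subseteq> I"
  shows "mat_det R S (principal_submat B S) = \<one>"
proof -
  have fin: "finite S" using S finite_I by (rule finite_subset)
  have BC: "B (i, j) \<in> carrier R" if "i \<in> S" "j \<in> S" for i j
    using B S that mat_entry_closed[of B R I i j] by (auto simp: walk_unipotent_def)
  define t where
    "t p = (if evenperm p then \<one> else \<ominus> \<one>) \<otimes> (\<Otimes>i\<in>S. principal_submat B S (i, p i))" for p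
  have "t p = (if p = id then \<one> else \<zero>)" if p: "p permutes S" for p
  proof -
    have "(\<Otimes>i\<in>S. principal_submat B S (i, p i)) = (\<Otimes>i\<in>S. B (i, p i))"
      using BC permutes_in_image[OF p] by (intro finprod_cong') (auto simp: principal_submat_def)
    also have "\<dots> = (\<Otimes>i\<in>{i. p i \<noteq> i}. off_diagonal R B (i, p i))"
      using fin BC B S p by (intro finprod_moved) (auto simp: walk_unipotent_def)
    finally have prod: "(\<Otimes>i\<in>S. principal_submat B S (i, p i)) =
        (\<Otimes>i\<in>{i. p i \<noteq> i}. off_diagonal R B (i, p i))" .
    show ?thesis
    proof (cases "p = id")
      case True
      then show ?thesis using prod by (simp add: t_def)
    next
      case False
      have T: "{i. p i \<noteq> i} \<subseteq> S" using p by (auto simp: permutes_def)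
      have "(\<Otimes>i\<in>{i. p i \<noteq> i}. off_diagonal R B (i, p i)) = \<zero>"
      proof (rule finprod_zero_along_permutation[where J = "walk_ideal 1" and p = p])
        show "finite {i. p i \<noteq> i}" using T fin by (rule finite_subset)
        show "{i. p i \<noteq> i} \<noteq> {}" using False by (auto simp: fun_eq_iff)
        show "p permutes {i. p i \<noteq> i}" using p by (rule permutes_moved)
        fix i assume "i \<in> {i. p i \<noteq> i}"
        moreover from this have "i \<in> I" "p i \<in> I" using T S permutes_in_image[OF p] by auto
        ultimately show "off_diagonal R B (i, p i) \<in> walk_ideal 1 i (p i)"
          using B by (auto simp: off_diagonal_def walk_unipotent_def)
      next
        fix i j k x y assume "x \<in> walk_ideal 1 i j" "y \<in> walk_ideal 1 j k"
        then show "x \<otimes> y \<in> walk_ideal 1 i k"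
          using walk_ideal_mult walk_ideal_antimono[of 1 "1 + 1"] by fastforce
      qed (simp_all only: walk_ideal_closed walk_ideal_loop)
      then show ?thesis using False prod by (simp add: t_def)
    qed
  qed
  then have "(\<Oplus>p\<in>{p. p permutes S}. t p) =
      (\<Oplus>p\<in>{p. p permutes S}. if id = p then \<one> else \<zero>)"
    by (intro finsum_cong') auto
  also have "\<dots> = \<one>"
    using finite_permutations[OF fin] by (intro add.finprod_singleton) auto
  finally show ?thesis by (simp add: mat_det_def t_def)
qed

lemma walk_unipotent_mult:
  assumes "walk_unipotent B" "walk_unipotent C"
  shows "walk_unipotent (B \<otimes>\<^bsub>mat_ring R I\<^esub> C)"
proof -
  have carr: "B \<in> carrier (mat_ring R I)" "C \<in> carrier (mat_ring R I)"
    and diag: "\<And>i. i \<in> I \<Longrightarrow> B (i, i) = \<one>" "\<And>i. i \<in> I \<Longrightarrow> C (i, i) = \<one>"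
    and off: "\<And>i j. \<lbrakk>i \<in> I; j \<in> I; i \<noteq> j\<rbrakk> \<Longrightarrow> B (i, j) \<in> walk_ideal 1 i j"
      "\<And>i j. \<lbrakk>i \<in> I; j \<in> I; i \<noteq> j\<rbrakk> \<Longrightarrow> C (i, j) \<in> walk_ideal 1 i j"
    using assms by (auto simp: walk_unipotent_def)
  have prod: "B (i, k) \<otimes> C (k, j) \<in> walk_ideal 1 i j"
    if "i \<in> I" "j \<in> I" "k \<in> I" "i \<noteq> k" "k \<noteq> j" for i j k
    using walk_ideal_mult[OF off(1) off(2), of i k j] that walk_ideal_antimono[of 1 "1 + 1" i j] by auto
  show ?thesis unfolding walk_unipotent_def
  proof (intro conjI ballI impI)
    show "B \<otimes>\<^bsub>mat_ring R I\<^esub> C \<in> carrier (mat_ring R I)" using carr by simp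
  next
    fix i assume i: "i \<in> I"
    have "B (i, k) \<otimes> C (k, i) = (if i = k then \<one> else \<zero>)" if "k \<in> I" for k
      using prod[of i i k] walk_ideal_loop[of i] i that diag by auto
    then have "(\<Oplus>k\<in>I. B (i, k) \<otimes> C (k, i)) = (\<Oplus>k\<in>I. if i = k then \<one> else \<zero>)"
      by (intro finsum_cong') auto
    also have "\<dots> = \<one>" using i finite_I by (intro add.finprod_singleton) auto
    finally show "(B \<otimes>\<^bsub>mat_ring R I\<^esub> C) (i, i) = \<one>" using i by (simp add: mat_entry)
  next
    fix i j assume i: "i \<in> I" and j: "j \<in> I" and ij: "i \<noteq> j"
    have "(\<Oplus>k\<in>I. B (i, k) \<otimes> C (k, j)) \<in> walk_ideal 1 i j"
    proof (rule finsum_in_ideal[OF ideal_walk_ideal finite_I])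
      fix k assume k: "k \<in> I"
      consider "k = i" | "k = j" | "i \<noteq> k" "k \<noteq> j" by blast
      then show "B (i, k) \<otimes> C (k, j) \<in> walk_ideal 1 i j"
      proof cases
        case 1
        then show ?thesis using off(2)[OF i j ij] diag(1) i j carr by simp
      next
        case 2
        then show ?thesis using off(1)[OF i j ij] diag(2) i j carr by simp
      next
        case 3
        then show ?thesis using prod i j k by blast
      qed
    qed
    then show "(B \<otimes>\<^bsub>mat_ring R I\<^esub> C) (i, j) \<in> walk_ideal 1 i j"
      using i j by (simp add: mat_entry)
  qed
qed

lemma walk_unipotent_one: "walk_unipotent \<one>\<^bsub>mat_ring R I\<^esub>"
  using additive_subgroup.zero_closed[OF ideal.axioms(1)[OF ideal_walk_ideal]]
  by (auto simp: walk_unipotent_def mat_entry)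

lemma walk_unipotent_pow:
  "walk_unipotent B \<Longrightarrow> walk_unipotent (B [^]\<^bsub>mat_ring R I\<^esub> (k :: nat))"
  by (induction k) (auto simp: walk_unipotent_one walk_unipotent_mult)

lemma walk_unipotent_add:
  assumes "walk_unipotent B" "walk_filtered k P" "1 \<le> k"
  shows "walk_unipotent (B \<oplus>\<^bsub>mat_ring R I\<^esub> P)"
proof -
  have P: "P (i, j) \<in> walk_ideal 1 i j" if "i \<in> I" "j \<in> I" for i j
    using assms that walk_ideal_antimono[of 1 k i j] by (auto simp: walk_filtered_def)
  have "P (i, i) = \<zero>" if "i \<in> I" for i using P[OF that that] walk_ideal_loop[of i] by blast
  then show ?thesis
    using assms P additive_subgroup.a_closed[OF ideal.axioms(1)[OF ideal_walk_ideal]]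
    by (auto simp: walk_unipotent_def walk_filtered_def mat_entry)
qed

lemma walk_filtered_mult:
  assumes "walk_filtered k P" "walk_filtered l Q"
  shows "walk_filtered (k + l) (P \<otimes>\<^bsub>mat_ring R I\<^esub> Q)"
  using assms
  by (auto simp: walk_filtered_def mat_entry
      intro!: finsum_in_ideal[OF ideal_walk_ideal finite_I] walk_ideal_mult)

lemma walk_filtered_pow:
  assumes "walk_filtered 1 P"
  shows "walk_filtered (Suc k) (P [^]\<^bsub>mat_ring R I\<^esub> Suc k)"
proof (induction k)
  case 0
  interpret M: ring "mat_ring R I" by (rule ring_mat_ring[OF finite_I])
  show ?case using assms by (simp add: walk_filtered_def)
next
  case (Suc k)
  then show ?case using walk_filtered_mult[OF Suc assms] by simp
qed

lemma walk_filtered_one_minus: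
  assumes A: "walk_unipotent A"
  shows "walk_filtered 1 (\<one>\<^bsub>mat_ring R I\<^esub> \<ominus>\<^bsub>mat_ring R I\<^esub> A)"
proof -
  interpret M: ring "mat_ring R I" by (rule ring_mat_ring[OF finite_I])
  let ?P = "\<one>\<^bsub>mat_ring R I\<^esub> \<ominus>\<^bsub>mat_ring R I\<^esub> A"
  have A': "A \<in> carrier (mat_ring R I)" using A by (simp add: walk_unipotent_def)
  then have P: "?P \<in> carrier (mat_ring R I)" by simp
  have "?P \<oplus>\<^bsub>mat_ring R I\<^esub> A = \<one>\<^bsub>mat_ring R I\<^esub>"
    using A' by (simp add: M.minus_eq M.a_assoc M.l_neg)
  then have eq: "?P (i, j) \<oplus> A (i, j) = (if i = j then \<one> else \<zero>)" if "i \<in> I" "j \<in> I" for i j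
    using that by (metis mat_entry(2,3))
  have "?P (i, j) \<in> walk_ideal 1 i j" if ij: "i \<in> I" "j \<in> I" for i j
  proof -
    interpret J: ideal "walk_ideal 1 i j" R by (rule ideal_walk_ideal)
    have c: "?P (i, j) \<in> carrier R" "A (i, j) \<in> carrier R"
      using ij P A' mat_entry_closed by blast+
    show ?thesis
    proof (cases "i = j")
      case True
      then have "?P (i, j) \<oplus> \<one> = \<one>" using eq[OF ij] A ij by (simp add: walk_unipotent_def)
      then have "?P (i, j) = \<zero>" using c by (metis add.l_cancel_one' one_closed a_comm)
      then show ?thesis using J.zero_closed by simp
    next
      case False
      then have "?P (i, j) = \<ominus> A (i, j)" using eq[OF ij] c minus_equality[of "?P (i, j)" "A (i, j)"] by simp
      moreover have "A (i, j) \<in> walk_ideal 1 i j"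
        using A False ij by (simp add: walk_unipotent_def)
      ultimately show ?thesis using J.a_inv_closed by simp
    qed
  qed
  with P show ?thesis by (auto simp: walk_filtered_def)
qed

text \<open>
  Writing \<open>A = 1 - P\<close>, the powers of \<open>P\<close> have entries in the ideals of longer and longer walks and
  so vanish eventually. The inverse is therefore the finite geometric series in \<open>P\<close>, and its partial
  sums keep the required form.
\<close>
lemma walk_unipotent_inverse:
  assumes A: "walk_unipotent A"
  shows "walk_unipotent (inv\<^bsub>mat_ring R I\<^esub> A)"
proof -
  let ?M = "mat_ring R I"
  interpret M: ring ?M by (rule ring_mat_ring[OF finite_I])
  define P where "P = \<one>\<^bsub>?M\<^esub> \<ominus>\<^bsub>?M\<^esub> A"
  have A': "A \<in> carrier ?M" using A by (simp add: walk_unipotent_def)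
  then have P': "P \<in> carrier ?M" by (simp add: P_def)
  have AP: "A = \<one>\<^bsub>?M\<^esub> \<ominus>\<^bsub>?M\<^esub> P" using A' by (simp add: P_def M.minus_eq M.minus_add M.a_assoc[symmetric] M.r_neg)
  have P: "walk_filtered 1 P" unfolding P_def by (rule walk_filtered_one_minus[OF A])
  \<comment> \<open>\<open>G\<close> is the partial sum \<open>1 + P + \<dots> + P\<^sup>k\<close>, an inverse of \<open>A\<close> up to the error \<open>P\<^bsup>k+1\<^esup>\<close>.\<close>
  have ex: "\<exists>G. walk_unipotent G \<and> A \<otimes>\<^bsub>?M\<^esub> G = \<one>\<^bsub>?M\<^esub> \<ominus>\<^bsub>?M\<^esub> P [^]\<^bsub>?M\<^esub> Suc k \<and>
      G \<otimes>\<^bsub>?M\<^esub> A = \<one>\<^bsub>?M\<^esub> \<ominus>\<^bsub>?M\<^esub> P [^]\<^bsub>?M\<^esub> Suc k" for k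
  proof (induction k)
    case 0
    show ?case using walk_unipotent_one A' P' AP by (intro exI[of _ "\<one>\<^bsub>?M\<^esub>"]) simp
  next
    case (Suc k)
    then obtain G where G: "walk_unipotent G"
      "A \<otimes>\<^bsub>?M\<^esub> G = \<one>\<^bsub>?M\<^esub> \<ominus>\<^bsub>?M\<^esub> P [^]\<^bsub>?M\<^esub> Suc k" "G \<otimes>\<^bsub>?M\<^esub> A = \<one>\<^bsub>?M\<^esub> \<ominus>\<^bsub>?M\<^esub> P [^]\<^bsub>?M\<^esub> Suc k"
      by blast
    let ?Q = "P [^]\<^bsub>?M\<^esub> Suc k"
    have G': "G \<in> carrier ?M" using G by (simp add: walk_unipotent_def)
    have Q: "?Q \<in> carrier ?M" using P' by blast
    have PQ: "P \<otimes>\<^bsub>?M\<^esub> ?Q = P [^]\<^bsub>?M\<^esub> Suc (Suc k)" "?Q \<otimes>\<^bsub>?M\<^esub> P = P [^]\<^bsub>?M\<^esub> Suc (Suc k)"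
      by (rule M.nat_pow_Suc2[OF P', symmetric], rule M.nat_pow_Suc[symmetric])
    have alg: "\<one>\<^bsub>?M\<^esub> \<ominus>\<^bsub>?M\<^esub> B \<oplus>\<^bsub>?M\<^esub> (B \<ominus>\<^bsub>?M\<^esub> C) = \<one>\<^bsub>?M\<^esub> \<ominus>\<^bsub>?M\<^esub> C"
      if "B \<in> carrier ?M" "C \<in> carrier ?M" for B C
      using that by (simp add: M.minus_eq M.a_assoc M.r_neg1)
    have "A \<otimes>\<^bsub>?M\<^esub> ?Q = ?Q \<ominus>\<^bsub>?M\<^esub> P [^]\<^bsub>?M\<^esub> Suc (Suc k)"
      "?Q \<otimes>\<^bsub>?M\<^esub> A = ?Q \<ominus>\<^bsub>?M\<^esub> P [^]\<^bsub>?M\<^esub> Suc (Suc k)"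
      unfolding AP using P' Q
      by (simp_all only: M.minus_eq M.l_distr M.r_distr M.l_minus M.r_minus M.l_one M.r_one
          M.one_closed M.a_inv_closed PQ)
    then have "A \<otimes>\<^bsub>?M\<^esub> (G \<oplus>\<^bsub>?M\<^esub> ?Q) = \<one>\<^bsub>?M\<^esub> \<ominus>\<^bsub>?M\<^esub> P [^]\<^bsub>?M\<^esub> Suc (Suc k)"
      "(G \<oplus>\<^bsub>?M\<^esub> ?Q) \<otimes>\<^bsub>?M\<^esub> A = \<one>\<^bsub>?M\<^esub> \<ominus>\<^bsub>?M\<^esub> P [^]\<^bsub>?M\<^esub> Suc (Suc k)"
      using G A' G' Q P' alg[OF Q, of "P [^]\<^bsub>?M\<^esub> Suc (Suc k)"]
      by (simp_all only: M.l_distr M.r_distr M.nat_pow_closed)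
    then show ?case
      using walk_unipotent_add[OF G(1) walk_filtered_pow[OF P, of k]] by auto
  qed
  have "Z = \<zero>\<^bsub>?M\<^esub>" if Z: "walk_filtered (Suc (card I)) Z" for Z
  proof (rule mat_eqI[of _ R I])
    fix i j assume ij: "i \<in> I" "j \<in> I"
    then have "Z (i, j) \<in> {\<zero>}"
      using Z walk_ideal_long[OF le_SucI[OF order_refl], of i j] unfolding walk_filtered_def by blast
    then show "Z (i, j) = \<zero>\<^bsub>?M\<^esub> (i, j)" using ij by (simp add: mat_entry)
  qed (use Z in \<open>simp_all add: walk_filtered_def\<close>)
  then have zero: "P [^]\<^bsub>?M\<^esub> Suc (card I) = \<zero>\<^bsub>?M\<^esub>"
    using walk_filtered_pow[OF P] by blast
  obtain G where G: "walk_unipotent G" "A \<otimes>\<^bsub>?M\<^esub> G = \<one>\<^bsub>?M\<^esub>" "G \<otimes>\<^bsub>?M\<^esub> A = \<one>\<^bsub>?M\<^esub>"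
    using ex[of "card I"] unfolding zero by (auto simp: M.minus_eq)
  then have "G = inv\<^bsub>?M\<^esub> A" using A' by (intro M.inv_unique') (auto simp: walk_unipotent_def)
  with G show ?thesis by simp
qed

lemma walk_unipotent_int_pow:
  assumes "walk_unipotent A"
  shows "walk_unipotent (A [^]\<^bsub>mat_ring R I\<^esub> (m :: int))"
  unfolding int_pow_def2
  by (simp only: assms walk_unipotent_pow walk_unipotent_inverse if_cancel split: if_split) blast

end

section \<open>Reduction modulo a nonzero element\<close>

lemma (in ring_hom_cring) hom_mat_det:
  assumes a: "\<And>i j. \<lbrakk>i \<in> T; j \<in> T\<rbrakk> \<Longrightarrow> a (i, j) \<in> carrier R"
    and A: "\<And>i j. \<lbrakk>i \<in> T; j \<in> T\<rbrakk> \<Longrightarrow> A (i, j) = h (a (i, j))"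
  shows "h (mat_det R T a) = mat_det S T A"
proof -
  let ?t = "\<lambda>p. (if evenperm p then \<one> else \<ominus> \<one>) \<otimes> (\<Otimes>i\<in>T. a (i, p i))"
  have prod: "(\<lambda>i. a (i, p i)) \<in> T \<rightarrow> carrier R" if "p permutes T" for p
    using a permutes_in_image[OF that] by auto
  have t: "?t p \<in> carrier R" if "p permutes T" for p
    using R.finprod_closed[OF prod[OF that]] by simp
  have "h (mat_det R T a) = (\<Oplus>\<^bsub>S\<^esub>p\<in>{p. p permutes T}. (h \<circ> ?t) p)"
    unfolding mat_det_def using t by (intro hom_finsum) auto
  also have "\<dots> = mat_det S T A" unfolding mat_det_def
  proof (rule S.finsum_cong')
    show "(\<lambda>p. (if evenperm p then \<one>\<^bsub>S\<^esub> else \<ominus>\<^bsub>S\<^esub> \<one>\<^bsub>S\<^esub>) \<otimes>\<^bsub>S\<^esub> (\<Otimes>\<^bsub>S\<^esub>i\<in>T. A (i, p i)))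
        \<in> {p. p permutes T} \<rightarrow> carrier S"
    proof
      fix p assume "p \<in> {p. p permutes T}"
      then have "(\<Otimes>\<^bsub>S\<^esub>i\<in>T. A (i, p i)) \<in> carrier S"
        using a A permutes_in_image[of p T] by (intro S.finprod_closed) auto
      then show "(if evenperm p then \<one>\<^bsub>S\<^esub> else \<ominus>\<^bsub>S\<^esub> \<one>\<^bsub>S\<^esub>) \<otimes>\<^bsub>S\<^esub> (\<Otimes>\<^bsub>S\<^esub>i\<in>T. A (i, p i)) \<in> carrier S"
        by simp
    qed
    fix p assume p: "p \<in> {p. p permutes T}"
    have "h (\<Otimes>i\<in>T. a (i, p i)) = (\<Otimes>\<^bsub>S\<^esub>i\<in>T. (h \<circ> (\<lambda>i. a (i, p i))) i)"
      using prod p by (intro hom_finprod) auto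
    also have "\<dots> = (\<Otimes>\<^bsub>S\<^esub>i\<in>T. A (i, p i))"
      using a A p permutes_in_image[of p T] by (intro S.finprod_cong') auto
    finally have "h (\<Otimes>i\<in>T. a (i, p i)) = (\<Otimes>\<^bsub>S\<^esub>i\<in>T. A (i, p i))" .
    then show "(h \<circ> ?t) p = (if evenperm p then \<one>\<^bsub>S\<^esub> else \<ominus>\<^bsub>S\<^esub> \<one>\<^bsub>S\<^esub>) \<otimes>\<^bsub>S\<^esub> (\<Otimes>\<^bsub>S\<^esub>i\<in>T. A (i, p i))"
      using R.finprod_closed[OF prod, of p] p by simp
  qed simp
  finally show ?thesis .
qed

lemma (in cring) mat_det_principal_submat:
  assumes "\<And>i j. \<lbrakk>i \<in> S; j \<in> S\<rbrakk> \<Longrightarrow> A (i, j) \<in> carrier R"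
  shows "mat_det R S (principal_submat A S) = mat_det R S A"
proof -
  have "(\<Otimes>i\<in>S. principal_submat A S (i, p i)) = (\<Otimes>i\<in>S. A (i, p i))" if p: "p permutes S" for p
    using assms permutes_in_image[OF p] by (intro finprod_cong') (auto simp: principal_submat_def)
  moreover have "(\<Otimes>i\<in>S. A (i, p i)) \<in> carrier R" if p: "p permutes S" for p
    using assms permutes_in_image[OF p] by (intro finprod_closed) auto
  ultimately show ?thesis unfolding mat_det_def by (intro finsum_cong') auto
qed

text \<open>
  The divisibility of cycle products is applied to a lift of \<open>A\<close> to \<open>D\<close>. The diagonal of \<open>A\<close> is
  \<open>1\<close> by the principal minors of size one, so the lift may be taken with diagonal exactly \<open>1\<close>.
\<close>
lemma (in normal_domain) null_cycles_quotient:
  assumes f: "f \<in> carrier D" "f \<noteq> \<zero>" and A: "one_principled (D Quot (PIdl f)) n A"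
  shows "null_cycles (D Quot (PIdl f)) {1..n} (off_diagonal (D Quot (PIdl f)) A)"
    and "\<And>i. i \<in> {1..n} \<Longrightarrow> A (i, i) = \<one>\<^bsub>D Quot (PIdl f)\<^esub>"
proof -
  let ?Q = "D Quot (PIdl f)"
  have idf: "ideal (PIdl f) D" using f(1) by (rule cgenideal_ideal)
  interpret J: ideal "PIdl f" D by fact
  interpret h: ring_hom_cring D ?Q "(+>) (PIdl f)" by (rule J.rcos_ring_hom_cring[OF is_cring])
  have A': "A \<in> carrier (mat_ring ?Q {1..n})"
    and det: "\<And>S. S \<subseteq> {1..n} \<Longrightarrow> mat_det ?Q S (principal_submat A S) = \<one>\<^bsub>?Q\<^esub>"
    using A by (auto simp: one_principled_def)
  have AC: "A (i, j) \<in> carrier ?Q" if "i \<in> {1..n}" "j \<in> {1..n}" for i j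
    using mat_entry_closed[OF A' that] .
  have det': "mat_det ?Q S A = \<one>\<^bsub>?Q\<^esub>" if "S \<subseteq> {1..n}" for S
    using det[OF that] that AC h.S.mat_det_principal_submat[of S A] by (simp add: subset_iff)
  show diag: "A (i, i) = \<one>\<^bsub>?Q\<^esub>" if "i \<in> {1..n}" for i
  proof -
    have "mat_det ?Q {i} A = A (i, i)"
      using AC[OF that that] by (simp add: mat_det_def)
    then show ?thesis using det'[of "{i}"] that by simp
  qed
  have "\<exists>x\<in>carrier D. A (i, j) = PIdl f +> x" if "i \<in> {1..n}" "j \<in> {1..n}" for i j
    using AC[OF that] unfolding FactRing_def A_RCOSETS_def' by (simp only: partial_object.simps) blast
  then obtain c where c: "\<And>i j. \<lbrakk>i \<in> {1..n}; j \<in> {1..n}\<rbrakk> \<Longrightarrow>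
      c i j \<in> carrier D \<and> A (i, j) = PIdl f +> c i j"
    by metis
  define a where "a = (\<lambda>(i, j). if i = j then \<one> else c i j)"
  have a: "a (i, j) \<in> carrier D" "A (i, j) = PIdl f +> a (i, j)"
    if "i \<in> {1..n}" "j \<in> {1..n}" for i j
    using c[OF that] diag[OF that(1)] h.hom_one by (auto simp: a_def)
  have div: "f divides x \<longleftrightarrow> PIdl f +> x = \<zero>\<^bsub>?Q\<^esub>" if "x \<in> carrier D" for x
  proof -
    have "\<zero>\<^bsub>?Q\<^esub> = PIdl f" by (simp only: FactRing_def ring.simps)
    then show ?thesis
      unfolding divides_iff_in_cgenideal[OF f(1)]
      using that a_rcos_zero[OF idf] J.rcos_const_imp_mem by metis
  qed
  have fdet: "f divides (mat_det D S a \<ominus> \<one>)" if S: "S \<subseteq> {1..n}" for S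
  proof -
    have aS: "a (i, j) \<in> carrier D" "A (i, j) = PIdl f +> a (i, j)" if "i \<in> S" "j \<in> S" for i j
      using a[of i j] subsetD[OF S that(1)] subsetD[OF S that(2)] by blast+
    have "mat_det D S a \<in> carrier D" unfolding mat_det_def
      using aS(1) permutes_in_image[of _ S] by (intro finsum_closed Pi_I m_closed finprod_closed) auto
    moreover have "PIdl f +> mat_det D S a = \<one>\<^bsub>?Q\<^esub>"
      using h.hom_mat_det[of S a A] aS det'[OF S] by simp
    ultimately show ?thesis
      unfolding divides_iff_in_cgenideal[OF f(1)]
      by (subst quotient_eq_iff_same_a_r_cos[OF idf])
        (simp_all only: one_closed FactRing_def monoid.simps)
  qed
  show "null_cycles ?Q {1..n} (off_diagonal ?Q A)"
  proof (intro null_cycles.intro null_cycles_axioms.intro)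
    show "cring ?Q" by (rule h.S.is_cring)
    show "finite {1..n}" by simp
    show "off_diagonal ?Q A (i, j) \<in> carrier ?Q" if "i \<in> {1..n}" "j \<in> {1..n}" for i j
      using AC[OF that] by (simp add: off_diagonal_def)
  next
    fix S p assume S: "S \<subseteq> {1..n}" "S \<noteq> {}" "bij_betw p S S"
    let ?b = "\<lambda>i. off_diagonal D a (i, p i)"
    have "f divides (\<Otimes>i\<in>S. ?b i)"
      by (rule divides_cycle_products[of "{1..n}" a]) (use a f fdet S in \<open>simp_all add: a_def\<close>)
    have pS: "i \<in> {1..n}" "p i \<in> {1..n}" if "i \<in> S" for i
      using S that bij_betwE[OF S(3)] by blast+
    have b: "?b i \<in> carrier D" "off_diagonal ?Q A (i, p i) = PIdl f +> ?b i" if "i \<in> S" for i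
      using a[OF pS[OF that]] h.hom_zero zero_closed unfolding off_diagonal_def prod.case by metis+
    have "\<zero>\<^bsub>?Q\<^esub> = PIdl f +> (\<Otimes>i\<in>S. ?b i)"
      using \<open>f divides _\<close> div[of "\<Otimes>i\<in>S. ?b i"] b by (simp add: Pi_def)
    also have "\<dots> = (\<Otimes>\<^bsub>?Q\<^esub>i\<in>S. (((+>) (PIdl f)) \<circ> ?b) i)"
      using b by (intro h.hom_finprod) auto
    also have "\<dots> = (\<Otimes>\<^bsub>?Q\<^esub>i\<in>S. off_diagonal ?Q A (i, p i))"
      using b by (intro h.S.finprod_cong') auto
    finally show "(\<Otimes>\<^bsub>?Q\<^esub>i\<in>S. off_diagonal ?Q A (i, p i)) = \<zero>\<^bsub>?Q\<^esub>" by simp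
  qed
qed

theorem corollary5p10:
  fixes D (structure) and f :: 'a and n :: nat and A :: "nat \<times> nat \<Rightarrow> 'a set"
  assumes "normal_domain D"
    and "f \<in> carrier D" and "f \<noteq> \<zero>" and "f \<notin> Units D"
    and "one_principled (D Quot (PIdl f)) n A"
  shows "\<forall>m::int. one_principled (D Quot (PIdl f)) n (A [^]\<^bsub>mat_ring (D Quot (PIdl f)) {1..n}\<^esub> m)"
proof
  fix m :: int
  let ?Q = "D Quot (PIdl f)" and ?I = "{1..n}"
  interpret normal_domain D by fact
  interpret Q: null_cycles ?Q ?I "off_diagonal ?Q A"
    using assms by (intro null_cycles_quotient)
  have carr: "A \<in> carrier (mat_ring ?Q ?I)" using assms(5) by (simp add: one_principled_def)
  have "Q.walk_unipotent A"
    unfolding Q.walk_unipotent_def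
  proof (intro conjI ballI impI carr)
    show "A (i, i) = \<one>\<^bsub>?Q\<^esub>" if "i \<in> ?I" for i
      using null_cycles_quotient(2)[OF assms(2,3,5) that] .
    show "A (i, j) \<in> Q.walk_ideal 1 i j" if "i \<in> ?I" "j \<in> ?I" "i \<noteq> j" for i j
      using Q.entry_in_walk_ideal[OF that(1,2)] that(3) unfolding off_diagonal_def by simp
  qed
  then have "Q.walk_unipotent (A [^]\<^bsub>mat_ring ?Q ?I\<^esub> m)" by (rule Q.walk_unipotent_int_pow)
  then show "one_principled ?Q n (A [^]\<^bsub>mat_ring ?Q ?I\<^esub> m)"
    unfolding one_principled_def using Q.mat_det_walk_unipotent Q.walk_unipotent_def by blast
qed

end
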